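(* Let $(v_h^k,\varphi_h^k,\mu_h^k)_k$ be a discrete evolution: $\varphi_h^0\in\mathcal V^1(\mathcal T^0)$, and $v_h^k\in H(\mathrm{div},\mathcal T^k)$, $\varphi_h^k,\mu_h^k\in\mathcal V^1(\mathcal T^k)$ for $k\ge1$, such that for every $k\ge1$ and all $w\in H(\mathrm{div},\mathcal T^{k+1})$, $\Phi,\Psi\in\mathcal V^1(\mathcal T^{k+1})$: $$\tfrac1{2\tau}\big(\rho^kv_h^{k+1}-\rho^{k-1}v_h^k+\rho^{k-1}(v_h^{k+1}-v_h^k),w\big)+a(\rho^kv_h^k+J^k,v_h^{k+1},w)+(2\eta^kDv_h^{k+1},Dw)-(\mu_h^{k+1}\nabla\varphi_h^k+\rho^kg,w)=0,$$ $$\tfrac1\tau(\varphi_h^{k+1}-\mathcal P^{k+1}\varphi_h^k,\Phi)+(m(\varphi_h^k)\nabla\mu_h^{k+1},\nabla\Phi)+(v_h^{k+1}\cdot\nabla\varphi_h^k,\Phi)=0,$$ $$\sigma\epsilon(\nabla\varphi_h^{k+1},\nabla\Psi)+(F_+'(\varphi_h^{k+1})+F_-'(\mathcal P^{k+1}\varphi_h^k),\Psi)-(\mu_h^{k+1},\Psi)=0.$$ Assume that for every $k=0,1,\dots$ there holds, a.e. in $\Omega$, $$F(\mathcal P^{k+1}\varphi_h^k)+\tfrac12\sigma\epsilon|\nabla\mathcal P^{k+1}\varphi_h^k|^2\le F(\varphi_h^k)+\tfrac12\sigma\epsilon|\nabla\varphi_h^k|^2 .$$ Then for all $1\le k<l$: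 $$\begin{aligned}&\tfrac12(\rho^{k-1}v_h^k,v_h^k)+\int_\Omega F(\varphi_h^k)\,dx+\tfrac12\sigma\epsilon(\nabla\varphi_h^k,\nabla\varphi_h^k)+\tau\sum_{j=k}^{l-1}(\rho^jg,v_h^{j+1})\\&\ge\tfrac12(\rho^{l-1}v_h^l,v_h^l)+\int_\Omega F(\varphi_h^l)\,dx+\tfrac12\sigma\epsilon(\nabla\varphi_h^l,\nabla\varphi_h^l)\\&\quad+\tfrac12\sum_{j=k}^{l-1}(\rho^{j-1}(v_h^{j+1}-v_h^j),v_h^{j+1}-v_h^j)+\tau\sum_{j=k}^{l-1}(2\eta^jDv_h^{j+1},Dv_h^{j+1})\\&\quad+\tau\sum_{j=k}^{l-1}(m(\varphi_h^j)\nabla\mu_h^{j+1},\nabla\mu_h^{j+1})+\tfrac12\sigma\epsilon\sum_{j=k}^{l-1}\|\nabla\varphi_h^{j+1}-\nabla\mathcal P^{j+1}\varphi_h^j\|^2 .\end{aligned}$$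
   Context: $\Omega\subset\mathbb R^n$, $n\in\{2,3\}$, is a bounded domain; $(\cdot,\cdot)$ and $\|\cdot\|$ are the $L^2(\Omega)$ inner product and norm (for scalar-, vector- or matrix-valued functions). $\sigma,\epsilon>0$ and the time step $\tau>0$ are constants, $g\in L^2(\Omega)^n$ is the given gravitational force, $Dv=\frac12(\nabla v+(\nabla v)^t)$. Meshes and spaces: for each time index $k$, $\mathcal T^k$ is a conforming triangulation of $\overline\Omega$ into closed simplices (meshes for different $k$ may differ). $\mathcal V^j(\mathcal T^k)$, $j=1,2$, is the space of continuous functions on $\overline\Omega$ that are polynomials of degree at most $j$ on each $T\in\mathcal T^k$. $L^2_{(0)}(\Omega)$ is the space of $L^2$ functions with zero mean. $H(\mathrm{div},\mathcal T^k)=\{v\in\mathcal V^2(\mathcal T^k)^n:\ (\mathrm{div}\,v,q)=0\ \forall q\in\mathcal V^1(\mathcal T^k)\cap L^2_{(0)}(\Omega),\ v|_{\partial\Omega}=0\}$. Projection: $\mathcal P^k:H^1(\Omega)\to\mathcal V^1(\mathcal T^k)$ is a fixed projection operator with $\|\mathcal P^kv\|_{L^p(\Omega)}\le\|v\|_{L^p(\Omega)}$ and $\|\nabla\mathcal P^kv\|_{L^r(\Omega)}\le\|\nabla v\|_{L^r(\Omega)}$ for $v\in H^1(\Omega)$, $r\in[1,2]$, and $p\in[1,6)$ if $n=3$, $p\in[1,\infty)$ if $n=2$. Trilinear form: $a(u,v,w)=\frac12\int_\Omega((u\cdot\nabla)v)\cdot w\,dx-\frac12\int_\Omega((u\cdot\nabla)w)\cdot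 v\,dx$. Notation: $\rho^k=\rho(\varphi_h^k)$, $\eta^k=\eta(\varphi_h^k)$, $m^k=m(\varphi_h^k)$, $J^k=-\rho'(\varphi_h^k)m^k\nabla\mu_h^k$. Standing assumptions on the data: $\rho,\eta,m:\mathbb R\to\mathbb R$ are continuous with $\overline\rho\ge\rho\ge\underline\rho>0$, $\overline\eta\ge\eta\ge\underline\eta>0$, $\overline m\ge m\ge\underline m>0$. Moreover $\rho$ is smooth and monotone; for constants $0<\tilde\rho_1\le\tilde\rho_2$ it equals $\frac{\tilde\rho_2-\tilde\rho_1}2\varphi+\frac{\tilde\rho_1+\tilde\rho_2}2$ for $|\varphi|<1+\frac{\tilde\rho_1}{\tilde\rho_2-\tilde\rho_1}$ and is constant on each of $\varphi>1+\frac{2\tilde\rho_1}{\tilde\rho_2-\tilde\rho_1}$ and $\varphi<-1-\frac{2\tilde\rho_1}{\tilde\rho_2-\tilde\rho_1}$ ($\rho$ constant if $\tilde\rho_1=\tilde\rho_2$). $F=F_++F_-:\mathbb R\to\mathbb R$ is continuously differentiable, $F_+$ convex, $F_-$ concave (both differentiable). There are $C>0$ and $q\in[1,4]$ if $n=3$, $q\in[1,\infty)$ if $n=2$, with $|F(x)|\le C(1+|x|^q)$, $|F_\pm'(x)|\le C(1+|x|^{q-1})$. $F_+'$, viewed as an operator $H^1(\Omega)\to H^1(\Omega)^*$, is Newton (slantly) differentiable with Newton derivative $G$ satisfying $(G(\varphi)\delta\varphi,\delta\varphi)\ge0$ for all $\varphi,\delta\varphi\in H^1(\Omega)$. *)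

theory Defs
  imports "HOL-Analysis.Analysis"
begin

text \<open>Elements of function spaces over \<open>\<Omega>\<close> are represented by total functions on
  \<^typ>\<open>real^'n\<close>; only their values on \<open>\<Omega>\<close> (on the closure of \<open>\<Omega>\<close> for
  finite element functions) matter, and Lebesgue and Sobolev functions are to be read
  modulo equality almost everywhere in \<open>\<Omega>\<close>.\<close>

definition domain :: "(real^'n) set \<Rightarrow> bool" where
  "domain \<Omega> \<longleftrightarrow> open \<Omega> \<and> connected \<Omega> \<and> \<Omega> \<noteq> {}"

definition Lp :: "(real^'n) set \<Rightarrow> real \<Rightarrow> (real^'n \<Rightarrow> 'b::euclidean_space) set" where
  "Lp \<Omega> p = {f. f \<in> borel_measurable (lebesgue_on \<Omega>) \<and>
                 integrable (lebesgue_on \<Omega>) (\<lambda>x. norm (f x) powr p)}"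

definition Lp_norm :: "(real^'n) set \<Rightarrow> real \<Rightarrow> (real^'n \<Rightarrow> 'b::euclidean_space) \<Rightarrow> real" where
  "Lp_norm \<Omega> p f = (LINT x|lebesgue_on \<Omega>. norm (f x) powr p) powr (1 / p)"

text \<open>On matrices, \<open>\<bullet>\<close> is the Frobenius inner product.\<close>

definition L2_inner ::
  "(real^'n) set \<Rightarrow> (real^'n \<Rightarrow> 'b::euclidean_space) \<Rightarrow> (real^'n \<Rightarrow> 'b) \<Rightarrow> real" where
  "L2_inner \<Omega> f g = (LINT x|lebesgue_on \<Omega>. f x \<bullet> g x)"

definition L2_norm :: "(real^'n) set \<Rightarrow> (real^'n \<Rightarrow> 'b::euclidean_space) \<Rightarrow> real" where
  "L2_norm \<Omega> f = sqrt (L2_inner \<Omega> f f)"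

definition L2_zero_mean :: "(real^'n) set \<Rightarrow> (real^'n \<Rightarrow> real) set" where
  "L2_zero_mean \<Omega> = {q \<in> Lp \<Omega> 2. (LINT x|lebesgue_on \<Omega>. q x) = 0}"

definition locally_integrable ::
  "(real^'n) set \<Rightarrow> (real^'n \<Rightarrow> 'b::euclidean_space) \<Rightarrow> bool" where
  "locally_integrable \<Omega> f \<longleftrightarrow> (\<forall>K. compact K \<and> K \<subseteq> \<Omega> \<longrightarrow> f absolutely_integrable_on K)"

text \<open>First-order weak derivatives are tested with continuously differentiable functions of
  compact support (the convention of Gilbarg and Trudinger); by mollification this is the same
  as testing with smooth ones. The second argument is the gradient of the test function.\<close>

definition test_function ::
  "(real^'n) set \<Rightarrow> (real^'n \<Rightarrow> real) \<Rightarrow> (real^'n \<Rightarrow> real^'n) \<Rightarrow> bool" where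
  "test_function \<Omega> \<psi> d\<psi> \<longleftrightarrow>
     (\<forall>x. GDERIV \<psi> x :> d\<psi> x) \<and> continuous_on UNIV d\<psi> \<and>
     compact (closure {x. \<psi> x \<noteq> 0}) \<and> closure {x. \<psi> x \<noteq> 0} \<subseteq> \<Omega>"

definition has_weak_grad ::
  "(real^'n) set \<Rightarrow> (real^'n \<Rightarrow> real) \<Rightarrow> (real^'n \<Rightarrow> real^'n) \<Rightarrow> bool" where
  "has_weak_grad \<Omega> v G \<longleftrightarrow> locally_integrable \<Omega> v \<and> locally_integrable \<Omega> G \<and>
     (\<forall>\<psi> d\<psi>. test_function \<Omega> \<psi> d\<psi> \<longrightarrow>
       (\<forall>i. (LINT x|lebesgue_on \<Omega>. v x * d\<psi> x $ i) = - (LINT x|lebesgue_on \<Omega>. G x $ i * \<psi> x)))"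

text \<open>The weak gradient is unique up to null sets, so the choice is immaterial.\<close>

definition weak_grad :: "(real^'n) set \<Rightarrow> (real^'n \<Rightarrow> real) \<Rightarrow> real^'n \<Rightarrow> real^'n" where
  "weak_grad \<Omega> v = (SOME G. has_weak_grad \<Omega> v G)"

text \<open>Row \<open>i\<close> of the Jacobian is the gradient of component \<open>i\<close>, so that
  \<open>(u \<cdot> \<nabla>) v\<close> is \<open>weak_jac \<Omega> v x *v u x\<close>.\<close>

definition weak_jac :: "(real^'n) set \<Rightarrow> (real^'n \<Rightarrow> real^'n) \<Rightarrow> real^'n \<Rightarrow> real^'n^'n" where
  "weak_jac \<Omega> v x = (\<chi> i. weak_grad \<Omega> (\<lambda>y. v y $ i) x)"

definition weak_div :: "(real^'n) set \<Rightarrow> (real^'n \<Rightarrow> real^'n) \<Rightarrow> real^'n \<Rightarrow> real" where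
  "weak_div \<Omega> v x = trace (weak_jac \<Omega> v x)"

definition sym_grad :: "(real^'n) set \<Rightarrow> (real^'n \<Rightarrow> real^'n) \<Rightarrow> real^'n \<Rightarrow> real^'n^'n" where
  "sym_grad \<Omega> v x = (1/2) *\<^sub>R (weak_jac \<Omega> v x + transpose (weak_jac \<Omega> v x))"

definition trilinear ::
  "(real^'n) set \<Rightarrow> (real^'n \<Rightarrow> real^'n) \<Rightarrow> (real^'n \<Rightarrow> real^'n) \<Rightarrow> (real^'n \<Rightarrow> real^'n) \<Rightarrow> real" where
  "trilinear \<Omega> u v w =
     1/2 * (LINT x|lebesgue_on \<Omega>. (weak_jac \<Omega> v x *v u x) \<bullet> w x) -
     1/2 * (LINT x|lebesgue_on \<Omega>. (weak_jac \<Omega> w x *v u x) \<bullet> v x)"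

definition H1 :: "(real^'n) set \<Rightarrow> (real^'n \<Rightarrow> real) set" where
  "H1 \<Omega> = {v \<in> Lp \<Omega> 2. \<exists>G \<in> Lp \<Omega> 2. has_weak_grad \<Omega> v G}"

definition H1_norm :: "(real^'n) set \<Rightarrow> (real^'n \<Rightarrow> real) \<Rightarrow> real" where
  "H1_norm \<Omega> v = sqrt ((L2_norm \<Omega> v)\<^sup>2 + (L2_norm \<Omega> (weak_grad \<Omega> v))\<^sup>2)"

definition H1_dual :: "(real^'n) set \<Rightarrow> ((real^'n \<Rightarrow> real) \<Rightarrow> real) set" where
  "H1_dual \<Omega> = {L.
     (\<forall>u\<in>H1 \<Omega>. \<forall>v\<in>H1 \<Omega>. L (\<lambda>x. u x + v x) = L u + L v) \<and>
     (\<forall>c. \<forall>u\<in>H1 \<Omega>. L (\<lambda>x. c * u x) = c * L u) \<and>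
     (\<exists>B. \<forall>u\<in>H1 \<Omega>. \<bar>L u\<bar> \<le> B * H1_norm \<Omega> u)}"

definition H1_dual_norm :: "(real^'n) set \<Rightarrow> ((real^'n \<Rightarrow> real) \<Rightarrow> real) \<Rightarrow> real" where
  "H1_dual_norm \<Omega> L = (SUP u\<in>{u \<in> H1 \<Omega>. H1_norm \<Omega> u \<le> 1}. \<bar>L u\<bar>)"

text \<open>A real function \<open>f\<close> viewed as an operator from \<open>H\<^sup>1\<close> to its dual:
  \<open>\<phi>\<close> is sent to the functional \<open>\<psi> \<mapsto> (f(\<phi>), \<psi>)\<close>. The integrability
  condition excludes that well-definedness comes from integrals being 0 by convention.\<close>

definition superposition ::
  "(real^'n) set \<Rightarrow> (real \<Rightarrow> real) \<Rightarrow> (real^'n \<Rightarrow> real) \<Rightarrow> (real^'n \<Rightarrow> real) \<Rightarrow> real" where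
  "superposition \<Omega> f \<phi> \<psi> = L2_inner \<Omega> (\<lambda>x. f (\<phi> x)) \<psi>"

definition superposition_H1_dual :: "(real^'n) set \<Rightarrow> (real \<Rightarrow> real) \<Rightarrow> bool" where
  "superposition_H1_dual \<Omega> f \<longleftrightarrow>
     (\<forall>\<phi>\<in>H1 \<Omega>. superposition \<Omega> f \<phi> \<in> H1_dual \<Omega> \<and>
        (\<forall>\<psi>\<in>H1 \<Omega>. integrable (lebesgue_on \<Omega>) (\<lambda>x. f (\<phi> x) * \<psi> x)))"

text \<open>\<open>G\<close> is a Newton derivative (slanting function) of \<open>A\<close>: each \<open>G \<phi>\<close> is a
  bounded linear map from \<open>H\<^sup>1\<close> to its dual, and
  \<open>A (\<phi> + h) - A \<phi> - G (\<phi> + h) h\<close> is \<open>o(\<parallel>h\<parallel>)\<close> in the dual norm.\<close>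

definition newton_derivative ::
  "(real^'n) set \<Rightarrow> ((real^'n \<Rightarrow> real) \<Rightarrow> (real^'n \<Rightarrow> real) \<Rightarrow> real) \<Rightarrow>
   ((real^'n \<Rightarrow> real) \<Rightarrow> (real^'n \<Rightarrow> real) \<Rightarrow> (real^'n \<Rightarrow> real) \<Rightarrow> real) \<Rightarrow> bool" where
  "newton_derivative \<Omega> A G \<longleftrightarrow>
     (\<forall>\<phi>\<in>H1 \<Omega>.
        (\<forall>h\<in>H1 \<Omega>. G \<phi> h \<in> H1_dual \<Omega>) \<and>
        (\<forall>h\<in>H1 \<Omega>. \<forall>h'\<in>H1 \<Omega>. \<forall>\<psi>\<in>H1 \<Omega>. G \<phi> (\<lambda>x. h x + h' x) \<psi> = G \<phi> h \<psi> + G \<phi> h' \<psi>) \<and>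
        (\<forall>c. \<forall>h\<in>H1 \<Omega>. \<forall>\<psi>\<in>H1 \<Omega>. G \<phi> (\<lambda>x. c * h x) \<psi> = c * G \<phi> h \<psi>) \<and>
        (\<exists>B. \<forall>h\<in>H1 \<Omega>. H1_dual_norm \<Omega> (G \<phi> h) \<le> B * H1_norm \<Omega> h) \<and>
        (\<forall>e>0. \<exists>d>0. \<forall>h\<in>H1 \<Omega>. H1_norm \<Omega> h < d \<longrightarrow>
           H1_dual_norm \<Omega>
             (\<lambda>\<psi>. A (\<lambda>x. \<phi> x + h x) \<psi> - A \<phi> \<psi> - G (\<lambda>x. \<phi> x + h x) h \<psi>)
           \<le> e * H1_norm \<Omega> h))"

text \<open>In the library, \<open>triangulation\<close> means a finite set of simplices any two of which meet
  in a common (possibly empty) face.\<close>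

definition mesh :: "(real^'n) set \<Rightarrow> (real^'n) set set \<Rightarrow> bool" where
  "mesh \<Omega> \<T> \<longleftrightarrow> triangulation \<T> \<and> (\<forall>T\<in>\<T>. int CARD('n) simplex T) \<and> \<Union>\<T> = closure \<Omega>"

definition poly_deg_le :: "nat \<Rightarrow> (real^'n \<Rightarrow> real) \<Rightarrow> bool" where
  "poly_deg_le j p \<longleftrightarrow>
     (\<exists>c. \<forall>x. p x = (\<Sum>\<alpha> | (\<Sum>i\<in>(UNIV::'n set). \<alpha> i) \<le> j. c \<alpha> * (\<Prod>i\<in>UNIV. (x $ i) ^ \<alpha> i)))"

definition FE :: "nat \<Rightarrow> (real^'n) set \<Rightarrow> (real^'n) set set \<Rightarrow> (real^'n \<Rightarrow> real) set" where
  "FE j \<Omega> \<T> = {v. continuous_on (closure \<Omega>) v \<and>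
                   (\<forall>T\<in>\<T>. \<exists>p. poly_deg_le j p \<and> (\<forall>x\<in>T. v x = p x))}"

definition Hdiv :: "(real^'n) set \<Rightarrow> (real^'n) set set \<Rightarrow> (real^'n \<Rightarrow> real^'n) set" where
  "Hdiv \<Omega> \<T> = {v. (\<forall>i. (\<lambda>x. v x $ i) \<in> FE 2 \<Omega> \<T>) \<and>
                   (\<forall>q \<in> FE 1 \<Omega> \<T> \<inter> L2_zero_mean \<Omega>. L2_inner \<Omega> (weak_div \<Omega> v) q = 0) \<and>
                   (\<forall>x\<in>frontier \<Omega>. v x = 0)}"

text \<open>A projection of \<open>H\<^sup>1\<close> onto \<open>FE 1 \<Omega> \<T>\<close>, well defined on classes modulo equality almost
  everywhere. Linearity is not required.\<close>

definition H1_projection ::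
  "(real^'n) set \<Rightarrow> (real^'n) set set \<Rightarrow> ((real^'n \<Rightarrow> real) \<Rightarrow> real^'n \<Rightarrow> real) \<Rightarrow> bool" where
  "H1_projection \<Omega> \<T> P \<longleftrightarrow>
     (\<forall>v\<in>H1 \<Omega>. P v \<in> FE 1 \<Omega> \<T>) \<and>
     (\<forall>v\<in>H1 \<Omega>. \<forall>w\<in>H1 \<Omega>. (AE x in lebesgue_on \<Omega>. v x = w x) \<longrightarrow>
        (\<forall>x\<in>closure \<Omega>. P v x = P w x)) \<and>
     (\<forall>v\<in>FE 1 \<Omega> \<T>. \<forall>x\<in>closure \<Omega>. P v x = v x)"

end

theory Submission
  imports Defs
begin


text \<open>Testing the momentum equation with \<open>v\<^sup>k\<^sup>+\<^sup>1\<close> kills the trilinear form, and testing the phase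
  equation with \<open>\<mu>\<^sup>k\<^sup>+\<^sup>1\<close> and the potential equation with \<open>\<phi>\<^sup>k\<^sup>+\<^sup>1 - P \<phi>\<^sup>k\<close> makes the coupling
  terms cancel. Convexity of \<open>F\<^sub>+\<close>, concavity of \<open>F\<^sub>-\<close> and the energy inequality for the projection
  then give the estimate for one time step, and these estimates are added up. All integrals may be split because the
  weak gradient of a finite element function is essentially bounded. The weak gradient is a choice,
  so this needs existence of a bounded weak gradient and uniqueness: the former follows from the
  Lipschitz continuity of piecewise polynomials along segments, the latter from testing with a bump
  function times polynomials.\<close>

subsection \<open>Test functions\<close>

text \<open>The difficulty is less the algebra than the convention that an integral which does not
  exist is 0: linearity is available only once each summand is known to be integrable. Essential
  boundedness is the class used for this, because it is closed under products and implies
  integrability on a bounded open set. Among the factors of the integrals that get split, the force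
  \<open>g\<close> is the only one outside this class. The viscous and the mobility term are carried
  along as plain numbers, and the trilinear form is a difference of identical integrals, so none of
  these has to be split. No regularity of the boundary of \<open>\<Omega>\<close> is assumed, so
  finite element functions are not treated as globally Lipschitz: what is known of their gradients
  comes from segments inside \<open>\<Omega>\<close> and from the interiors of the cells. Meshes
  change from step to step. The gradients of \<open>\<phi> k\<close> and of its projection are
  therefore never subtracted; they are compared only through the assumed pointwise energy
  inequality, while every subtraction of gradients takes place on the new mesh.\<close>

lemma continuous_on_real_polynomial_function:
  "real_polynomial_function p \<Longrightarrow> continuous_on S p"
  by (simp add: continuous_on_polymonial_function real_polynomial_function_eq)

lemma real_polynomial_function_C1:
  fixes p :: "'a::euclidean_space \<Rightarrow> real"
  assumes "real_polynomial_function p"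
  shows "\<exists>dp. (\<forall>x. GDERIV p x :> dp x) \<and> continuous_on UNIV dp"
  using assms
proof (induction rule: real_polynomial_function.induct)
  case (linear f)
  \<comment> \<open>The adjoint applied to 1 is the vector that represents the functional
    \<open>f\<close>, hence its constant gradient.\<close>
  have "FDERIV f x :> (\<lambda>h. h \<bullet> adjoint f 1)" for x
  proof -
    have "(\<lambda>h. h \<bullet> adjoint f 1) = f"
      using adjoint_works[of f _ 1] bounded_linear.linear[OF linear] by auto
    then show ?thesis
      using bounded_linear_imp_has_derivative[OF linear] by simp
  qed
  then show ?case
    unfolding gderiv_def by (intro exI[of _ "\<lambda>_. adjoint f 1"]) auto
next
  case (const c)
  show ?case
    by (intro exI[of _ "\<lambda>_. 0"]) (auto simp: GDERIV_const)
next
  case (add f g)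
  then obtain df dg where "\<forall>x. GDERIV f x :> df x" "continuous_on UNIV df"
    "\<forall>x. GDERIV g x :> dg x" "continuous_on UNIV dg"
    by blast
  then show ?case
    by (intro exI[of _ "\<lambda>x. df x + dg x"]) (auto intro!: GDERIV_add continuous_intros)
next
  case (mult f g)
  then obtain df dg where d: "\<forall>x. GDERIV f x :> df x" "continuous_on UNIV df"
    "\<forall>x. GDERIV g x :> dg x" "continuous_on UNIV dg"
    by blast
  have "continuous_on UNIV f" "continuous_on UNIV g"
    using mult.hyps by (simp_all add: continuous_on_real_polynomial_function)
  with d show ?case
    by (intro exI[of _ "\<lambda>x. f x *\<^sub>R dg x + g x *\<^sub>R df x"])
       (auto intro!: GDERIV_mult continuous_intros)
qed

text \<open>Squaring the positive part removes the kink at the sphere, which gives exactly the C1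
  regularity that \<open>test_function\<close> asks for, while the function stays positive on the
  whole open ball.\<close>

definition bump :: "'a::euclidean_space \<Rightarrow> real \<Rightarrow> 'a \<Rightarrow> real" where
  "bump a r x = (max 0 (r\<^sup>2 - (x - a) \<bullet> (x - a)))\<^sup>2"

lemma pos_part_square_deriv: "((\<lambda>t::real. (max 0 t)\<^sup>2) has_real_derivative 2 * max 0 t) (at t)"
proof (cases t "0::real" rule: linorder_cases)
  case less
  have d: "((\<lambda>t::real. 0) has_real_derivative 2 * max 0 t) (at t)"
    using less by (auto intro!: derivative_eq_intros)
  have "\<forall>\<^sub>F s in nhds t. s \<in> {..<0::real}"
    using less by (intro eventually_nhds_in_open) auto
  then have e: "\<forall>\<^sub>F s in nhds t. 0 = (max 0 s)\<^sup>2"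
    by eventually_elim (simp add: max_def)
  show ?thesis
    using DERIV_cong_ev[OF refl e refl] d by (rule iffD1)
next
  case equal
  \<comment> \<open>This is the difference quotient at the point where the two branches
    meet.\<close>
  have "((\<lambda>h::real. (max 0 h)\<^sup>2 / h) \<longlongrightarrow> 0) (at 0)"
  proof (rule Lim_null_comparison)
    show "\<forall>\<^sub>F h in at 0. norm ((max 0 h)\<^sup>2 / h) \<le> \<bar>h::real\<bar>"
      by (auto simp: eventually_at power2_eq_square max_def intro!: exI[of _ 1])
    show "((\<lambda>h::real. \<bar>h\<bar>) \<longlongrightarrow> 0) (at 0)"
      by (rule tendsto_rabs_zero) (rule tendsto_ident_at)
  qed
  then show ?thesis
    using equal by (simp add: DERIV_def)
next
  case greater
  have d: "((\<lambda>t::real. t\<^sup>2) has_real_derivative 2 * max 0 t) (at t)"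
    using greater by (auto intro!: derivative_eq_intros)
  have "\<forall>\<^sub>F s in nhds t. s \<in> {0::real<..}"
    using greater by (intro eventually_nhds_in_open) auto
  then have e: "\<forall>\<^sub>F s in nhds t. s\<^sup>2 = (max 0 s)\<^sup>2"
    by eventually_elim (simp add: max_def)
  show ?thesis
    using DERIV_cong_ev[OF refl e refl] d by (rule iffD1)
qed

lemma bump_C1: "\<exists>db. (\<forall>x. GDERIV (bump a r) x :> db x) \<and> continuous_on UNIV db"
proof -
  have "GDERIV (bump a r) x :> (2 * max 0 (r\<^sup>2 - (x - a) \<bullet> (x - a))) *\<^sub>R (- 2 *\<^sub>R (x - a))" for x
    unfolding bump_def
  proof (rule GDERIV_DERIV_compose[OF _ pos_part_square_deriv])
    show "GDERIV (\<lambda>x. r\<^sup>2 - (x - a) \<bullet> (x - a)) x :> - 2 *\<^sub>R (x - a)"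
      unfolding gderiv_def
      by (auto intro!: derivative_eq_intros simp: inner_commute algebra_simps)
  qed
  moreover have "continuous_on UNIV (\<lambda>x. (2 * max 0 (r\<^sup>2 - (x - a) \<bullet> (x - a))) *\<^sub>R (- 2 *\<^sub>R (x - a)))"
    by (intro continuous_intros)
  ultimately show ?thesis
    by (intro exI[of _ "\<lambda>x. (2 * max 0 (r\<^sup>2 - (x - a) \<bullet> (x - a))) *\<^sub>R (- 2 *\<^sub>R (x - a))"]) simp
qed

lemma continuous_on_bump: "continuous_on S (bump a r)"
  unfolding bump_def by (intro continuous_intros)

lemma bump_pos_iff: "r > 0 \<Longrightarrow> bump a r x > 0 \<longleftrightarrow> x \<in> ball a r"
  unfolding bump_def
  by (auto simp: dist_norm norm_minus_commute power2_norm_eq_inner[symmetric] max_def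
      power2_le_iff_abs_le abs_le_square_iff[symmetric] power_strict_mono not_le)

lemma bump_nonneg: "0 \<le> bump a r x"
  by (simp add: bump_def)

lemma bump_eq_0: "r > 0 \<Longrightarrow> x \<notin> ball a r \<Longrightarrow> bump a r x = 0"
  using bump_pos_iff[of r a x] bump_nonneg[of a r x] by linarith

text \<open>The cutoff turns every polynomial into an admissible test function, so that
  Stone-Weierstrass can be applied to weak derivatives.\<close>

lemma test_function_bump_mult:
  fixes p :: "real^'n \<Rightarrow> real"
  assumes "real_polynomial_function p" "r > 0" "cball a r \<subseteq> \<Omega>"
  shows "\<exists>d\<psi>. test_function \<Omega> (\<lambda>x. bump a r x * p x) d\<psi>"
proof -
  obtain dp where dp: "\<forall>x. GDERIV p x :> dp x" "continuous_on UNIV dp"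
    using real_polynomial_function_C1[OF assms(1)] by blast
  obtain db where db: "\<forall>x. GDERIV (bump a r) x :> db x" "continuous_on UNIV db"
    using bump_C1 by blast
  have sub: "closure {x. bump a r x * p x \<noteq> 0} \<subseteq> cball a r"
  proof (rule closure_minimal)
    show "{x. bump a r x * p x \<noteq> 0} \<subseteq> cball a r"
    proof
      fix x assume "x \<in> {x. bump a r x * p x \<noteq> 0}"
      then have "bump a r x \<noteq> 0" by simp
      then show "x \<in> cball a r"
        using bump_eq_0[OF assms(2), of x a] ball_subset_cball[of a r] by (metis subsetD)
    qed
  qed simp
  have "compact (closure {x. bump a r x * p x \<noteq> 0})"
    using sub compact_cball by (meson bounded_cball bounded_subset closed_closure compact_eq_bounded_closed)
  moreover have "continuous_on UNIV (\<lambda>x. bump a r x *\<^sub>R dp x + p x *\<^sub>R db x)"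
    by (intro continuous_intros continuous_on_bump dp db continuous_on_real_polynomial_function assms)
  moreover have "GDERIV (\<lambda>x. bump a r x * p x) x :> (bump a r x *\<^sub>R dp x + p x *\<^sub>R db x)" for x
    using dp db by (auto intro: GDERIV_mult)
  ultimately show ?thesis
    unfolding test_function_def using sub assms(3)
    by (intro exI[of _ "\<lambda>x. bump a r x *\<^sub>R dp x + p x *\<^sub>R db x"]) auto
qed


section \<open>Functions orthogonal to all polynomials\<close>

lemma integrable_bounded_scaleR:
  fixes f :: "'a \<Rightarrow> 'b::{banach, second_countable_topology}"
  assumes "integrable M f" "h \<in> borel_measurable M" "AE x in M. \<bar>h x\<bar> \<le> B"
  shows "integrable M (\<lambda>x. h x *\<^sub>R f x)"
proof (rule Bochner_Integration.integrable_bound[of M "\<lambda>x. B *\<^sub>R f x"])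
  show "AE x in M. norm (h x *\<^sub>R f x) \<le> norm (B *\<^sub>R f x)"
    using assms(3) by eventually_elim (auto intro!: mult_right_mono)
qed (use assms in \<open>auto intro!: borel_measurable_scaleR\<close>)

text \<open>Orthogonality passes from continuous functions to indicators of closed sets by dominated
  convergence. A closed subset of the set where \<open>g\<close> is positive is then null, and inner
  regularity carries this over to the whole set.\<close>

lemma negligible_pos_if_continuous_integrals_zero:
  fixes g :: "'a::euclidean_space \<Rightarrow> real"
  assumes S: "S \<in> sets lebesgue" and g: "integrable (lebesgue_on S) g"
    and zero: "\<And>h. continuous_on UNIV h \<Longrightarrow> (\<forall>x. \<bar>h x\<bar> \<le> 1) \<Longrightarrow> (LINT x|lebesgue_on S. h x * g x) = 0"
  shows "negligible {x \<in> S. g x > 0}"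
proof -
  let ?M = "lebesgue_on S"
  have closed_zero: "(LINT x|?M. indicator C x * g x) = 0" if C: "closed C" "C \<noteq> {}" for C
  proof -
    \<comment> \<open>Cutoffs equal to 1 on \<open>C\<close> that decay with slope \<open>n\<close>
      in the distance; as \<open>C\<close> is closed, they tend to its indicator everywhere.\<close>
    define h where "h = (\<lambda>(n::nat) x. max 0 (1 - real n * infdist x C))"
    have hc: "continuous_on UNIV (h n)" for n
      unfolding h_def by (intro continuous_intros)
    have hb: "\<bar>h n x\<bar> \<le> 1" for n x
      unfolding h_def using infdist_nonneg[of x C] by (auto simp: max_def)
    have lim: "(\<lambda>n. h n x) \<longlonglongrightarrow> indicator C x" for x
    proof (cases "x \<in> C")
      case True
      then show ?thesis by (simp add: h_def)
    next
      case False
      then have d: "infdist x C > 0"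
        using C by (simp add: infdist_pos_not_in_closed)
      have "\<forall>\<^sub>F n in sequentially. real n \<ge> 1 / infdist x C"
        using filterlim_real_sequentially by (auto simp: filterlim_at_top)
      then have "\<forall>\<^sub>F n in sequentially. h n x = 0"
        by eventually_elim (use d in \<open>simp add: h_def field_simps max_def\<close>)
      then show ?thesis using False by (simp add: tendsto_eventually)
    qed
    have hm: "h n \<in> borel_measurable ?M" for n
      using S hc continuous_on_subset continuous_imp_measurable_on_sets_lebesgue by blast
    have "(\<lambda>n. LINT x|?M. h n x * g x) \<longlonglongrightarrow> (LINT x|?M. indicator C x * g x)"
    proof (rule integral_dominated_convergence[where w = "\<lambda>x. \<bar>g x\<bar>"])
      have "C \<in> sets lebesgue" using C by simp
      then have "indicator C \<in> borel_measurable ?M"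
        by (intro measurable_restrict_space1 borel_measurable_indicator)
      then show "(\<lambda>x. indicator C x * g x) \<in> borel_measurable ?M"
        using g by (intro borel_measurable_times) auto
      show "(\<lambda>x. h n x * g x) \<in> borel_measurable ?M" for n
        using g hm by (intro borel_measurable_times) auto
      show "AE x in ?M. (\<lambda>n. h n x * g x) \<longlonglongrightarrow> indicator C x * g x"
        using lim by (intro AE_I2 tendsto_mult_right) auto
      show "AE x in ?M. norm (h n x * g x) \<le> \<bar>g x\<bar>" for n
        using hb[of n] by (intro AE_I2) (simp add: abs_mult mult_left_le_one_le)
    qed (use g in auto)
    moreover have "(LINT x|?M. h n x * g x) = 0" for n
      using zero hc hb by blast
    ultimately show ?thesis
      by (simp add: LIMSEQ_const_iff)
  qed
  define A where "A = {x \<in> S. g x > 0}"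
  have "{x \<in> space ?M. g x > 0} \<in> sets ?M"
    using g by measurable
  then have A: "A \<in> sets lebesgue"
    using S by (auto simp: A_def sets_restrict_space_iff space_restrict_space)
  have "emeasure lebesgue A \<le> ennreal e" if e: "e > 0" for e
  proof -
    obtain T where T: "closed T" "T \<subseteq> A" "A - T \<in> lmeasurable" "emeasure lebesgue (A - T) < ennreal e"
      using sets_lebesgue_inner_closed[OF A e] by blast
    have Tl: "T \<in> sets lebesgue" using T by simp
    \<comment> \<open>On \<open>T\<close> the function \<open>g\<close> is positive while its
      integral vanishes. Once \<open>T\<close> is null, \<open>A\<close> has the same measure as
      \<open>A - T\<close>, which is below \<open>e\<close>.\<close>
    have "T \<in> null_sets lebesgue"
    proof (cases "T = {}")
      case False
      have "integrable ?M (\<lambda>x. indicator T x * g x)"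
        using integrable_mult_indicator[of T ?M g] g Tl T(2) S
        by (auto simp: sets_restrict_space_iff A_def)
      moreover have "AE x in ?M. 0 \<le> indicator T x * g x"
        using T(2) by (intro AE_I2) (auto simp: A_def indicator_def)
      ultimately have "AE x in ?M. indicator T x * g x = 0"
        using integral_nonneg_eq_0_iff_AE closed_zero[OF T(1) False] by blast
      then have "AE x in lebesgue. x \<notin> T"
        using S T(2) by (subst (asm) AE_restrict_space_iff) (auto simp: A_def indicator_def split: if_splits elim!: eventually_mono)
      then show ?thesis
        using Tl by (simp add: AE_iff_null_sets)
    qed simp
    then have "emeasure lebesgue (A - T) = emeasure lebesgue A"
      using A by (rule emeasure_Diff_null_set)
    then show ?thesis using T by simp
  qed
  then have "emeasure lebesgue A \<le> 0"
    using ennreal_le_epsilon[of 0 "emeasure lebesgue A"] by simp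
  then show ?thesis
    unfolding A_def[symmetric] negligible_iff_null_sets using A by auto
qed

text \<open>Compactness allows uniform approximation of continuous functions by polynomials, at the
  cost of the uniform error times the L1 norm of \<open>g\<close>. The sign is handled by treating
  \<open>g\<close> and \<open>- g\<close> separately.\<close>

lemma negligible_if_polynomial_integrals_zero:
  fixes g :: "'a::euclidean_space \<Rightarrow> real"
  assumes S: "compact S" and g: "integrable (lebesgue_on S) g"
    and zero: "\<And>p. real_polynomial_function p \<Longrightarrow> (LINT x|lebesgue_on S. p x * g x) = 0"
  shows "negligible {x \<in> S. g x \<noteq> 0}"
proof -
  let ?M = "lebesgue_on S"
  have Sl: "S \<in> sets lebesgue" using S by (simp add: compact_imp_closed)
  have hzero: "(LINT x|?M. h x * g x) = 0" if h: "continuous_on UNIV h" for h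
  proof -
    have hS: "continuous_on S h" using h continuous_on_subset by blast
    have int: "integrable ?M (\<lambda>x. h x * g x)" if h: "continuous_on S h" for h
    proof -
      obtain B where "\<forall>x\<in>S. \<bar>h x\<bar> \<le> B"
        using compact_imp_bounded[OF compact_continuous_image[OF h S]] unfolding bounded_iff by auto
      then have "AE x in ?M. \<bar>h x\<bar> \<le> B"
        by (intro AE_I2) (simp add: space_restrict_space)
      then show ?thesis
        using integrable_bounded_scaleR[OF g continuous_imp_measurable_on_sets_lebesgue[OF h Sl]] by simp
    qed
    define I where "I = (LINT x|?M. \<bar>g x\<bar>)"
    have I: "I \<ge> 0" unfolding I_def by simp
    have "\<bar>LINT x|?M. h x * g x\<bar> \<le> e" if e: "e > 0" for e
    proof -
      \<comment> \<open>The added 1 keeps the tolerance meaningful when the L1 norm \<open>I\<close>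
        is 0.\<close>
      obtain p where p: "real_polynomial_function p" "\<And>x. x \<in> S \<Longrightarrow> \<bar>h x - p x\<bar> < e / (I + 1)"
        using Stone_Weierstrass_real_polynomial_function[OF S hS, of "e / (I + 1)"] e I by auto
      have pc: "continuous_on S p" by (rule continuous_on_real_polynomial_function) fact
      have "(LINT x|?M. h x * g x) = (LINT x|?M. h x * g x) - (LINT x|?M. p x * g x)"
        using zero p by simp
      also have "\<dots> = (LINT x|?M. h x * g x - p x * g x)"
        using int[OF hS] int[OF pc] by simp
      also have "\<bar>\<dots>\<bar> \<le> (LINT x|?M. e / (I + 1) * \<bar>g x\<bar>)"
      proof (rule integral_abs_bound_integral)
        show "integrable ?M (\<lambda>x. h x * g x - p x * g x)"
          using int[OF hS] int[OF pc] by simp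
        show "\<bar>h x * g x - p x * g x\<bar> \<le> e / (I + 1) * \<bar>g x\<bar>" if "x \<in> space ?M" for x
        proof -
          have "\<bar>h x - p x\<bar> * \<bar>g x\<bar> \<le> e / (I + 1) * \<bar>g x\<bar>"
            using p(2)[of x] that by (intro mult_right_mono) (simp_all add: space_restrict_space)
          then show ?thesis by (simp only: left_diff_distrib[symmetric] abs_mult)
        qed
      qed (use g in auto)
      also have "\<dots> = e * (I / (I + 1))" by (simp add: I_def)
      also have "\<dots> \<le> e" using e I by (simp add: field_simps)
      finally show ?thesis .
    qed
    then have "\<bar>LINT x|?M. h x * g x\<bar> \<le> 0"
      by (rule field_le_epsilon) auto
    then show ?thesis by simp
  qed
  have "negligible {x \<in> S. g x > 0}"
    using negligible_pos_if_continuous_integrals_zero[OF Sl g hzero] by blast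
  moreover have "negligible {x \<in> S. - g x > 0}"
    using negligible_pos_if_continuous_integrals_zero[OF Sl, of "\<lambda>x. - g x"] g hzero by simp
  ultimately show ?thesis
    by (rule negligible_subset[OF negligible_Un]) auto
qed


subsection \<open>Weak gradients\<close>

lemma test_functionD:
  assumes "test_function \<Omega> \<psi> d\<psi>"
  obtains K where "compact K" "K \<subseteq> \<Omega>" "\<And>x. x \<notin> K \<Longrightarrow> \<psi> x = 0" "\<And>x. x \<notin> K \<Longrightarrow> d\<psi> x = 0"
    "continuous_on UNIV \<psi>" "continuous_on UNIV d\<psi>" "\<And>x. GDERIV \<psi> x :> d\<psi> x"
proof
  define K where "K = closure {x. \<psi> x \<noteq> 0}"
  show K: "compact K" "K \<subseteq> \<Omega>" and "continuous_on UNIV d\<psi>" and d: "\<And>x. GDERIV \<psi> x :> d\<psi> x"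
    using assms by (simp_all add: test_function_def K_def)
  show "continuous_on UNIV \<psi>"
    using d by (meson continuous_at_imp_continuous_on gderiv_def has_derivative_continuous)
  show zero: "\<psi> x = 0" if "x \<notin> K" for x
    using that closure_subset[of "{x. \<psi> x \<noteq> 0}"] unfolding K_def by blast
  show "d\<psi> x = 0" if x: "x \<notin> K" for x
  proof -
    \<comment> \<open>The complement of \<open>K\<close> is open and \<open>\<psi>\<close> vanishes
      on it, so near \<open>x\<close> it coincides with the zero function.\<close>
    have "((\<lambda>x. 0) has_derivative (\<lambda>h. 0)) (at x)" by simp
    then have "(\<psi> has_derivative (\<lambda>h. 0)) (at x)"
      by (rule has_derivative_transform_within_open[where s = "- K"]) (use x zero compact_imp_closed[OF K(1)] in \<open>simp_all add: open_Compl\<close>)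
    then have "(\<lambda>h. h \<bullet> d\<psi> x) = (\<lambda>h. 0)"
      using d[of x] unfolding gderiv_def by (rule has_derivative_unique[symmetric])
    then have "d\<psi> x \<bullet> d\<psi> x = 0" by metis
    then show ?thesis by simp
  qed
qed

lemma compact_support_bounded:
  fixes h :: "'a::euclidean_space \<Rightarrow> 'b::real_normed_vector"
  assumes "continuous_on UNIV h" "compact K" "\<And>x. x \<notin> K \<Longrightarrow> h x = 0"
  obtains B where "B \<ge> 0" "\<And>x. norm (h x) \<le> B"
proof -
  have "compact (h ` K)"
    using assms by (meson compact_continuous_image continuous_on_subset subset_UNIV)
  then obtain B where "\<forall>x\<in>K. norm (h x) \<le> B"
    using compact_imp_bounded[of "h ` K"] by (auto simp: bounded_iff)
  then have "norm (h x) \<le> max 0 B" for x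
    using assms(3)[of x] by (cases "x \<in> K") (auto intro: max.coboundedI2)
  then show ?thesis by (rule that[rotated]) simp
qed

text \<open>Guarantees that both sides of the defining identity of a weak gradient are genuine
  integrals, so that two such identities may be subtracted.\<close>

lemma integrable_test:
  fixes f :: "real^'n \<Rightarrow> 'b::euclidean_space"
  assumes \<Omega>: "open \<Omega>" and f: "locally_integrable \<Omega> f"
    and h: "continuous_on UNIV h" "compact K" "K \<subseteq> \<Omega>" "\<And>x. x \<notin> K \<Longrightarrow> h x = 0"
  shows "integrable (lebesgue_on \<Omega>) (\<lambda>x. h x *\<^sub>R f x)"
proof -
  obtain B where B: "\<And>x. norm (h x) \<le> B"
    using compact_support_bounded[OF h(1,2,4)] by blast
  have "integrable lebesgue (\<lambda>x. indicator K x *\<^sub>R f x)"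
    using f h unfolding locally_integrable_def set_integrable_def by auto
  moreover have "h \<in> borel_measurable lebesgue"
    using continuous_imp_measurable_on_sets_lebesgue[OF h(1)] by simp
  ultimately have "integrable lebesgue (\<lambda>x. h x *\<^sub>R indicator K x *\<^sub>R f x)"
    using B by (intro integrable_bounded_scaleR[where h = h and B = B]) auto
  also have "(\<lambda>x. h x *\<^sub>R indicator K x *\<^sub>R f x) = (\<lambda>x. indicator \<Omega> x *\<^sub>R h x *\<^sub>R f x)"
    using h by (auto simp: indicator_def fun_eq_iff)
  finally show ?thesis
    using \<Omega> by (subst integrable_restrict_space) auto
qed

lemma locally_integrable_component:
  fixes G :: "real^'n \<Rightarrow> real^'m"
  shows "locally_integrable \<Omega> G \<Longrightarrow> locally_integrable \<Omega> (\<lambda>x. G x $ i)"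
  unfolding locally_integrable_def
  using absolutely_integrable_component[of _ G "axis i 1"] by (simp add: inner_axis)

lemma locally_integrable_diff:
  "locally_integrable \<Omega> f \<Longrightarrow> locally_integrable \<Omega> g \<Longrightarrow> locally_integrable \<Omega> (\<lambda>x. f x - g x)"
  unfolding locally_integrable_def by (auto intro: set_integral_diff(1))

text \<open>Serves twice: with \<open>u = w\<close> it reduces uniqueness to weak gradients of zero,
  and for two finite element functions it yields the gradient of their difference.\<close>

lemma has_weak_grad_diff:
  assumes \<Omega>: "open \<Omega>" and u: "has_weak_grad \<Omega> u U" and w: "has_weak_grad \<Omega> w W"
  shows "has_weak_grad \<Omega> (\<lambda>x. u x - w x) (\<lambda>x. U x - W x)"
proof -
  note loc = u[unfolded has_weak_grad_def] w[unfolded has_weak_grad_def]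
  show ?thesis
    unfolding has_weak_grad_def
  proof (intro conjI allI impI)
    fix \<psi> d\<psi> i assume t: "test_function \<Omega> \<psi> d\<psi>"
    obtain K where K: "compact K" "K \<subseteq> \<Omega>" "\<And>x. x \<notin> K \<Longrightarrow> \<psi> x = 0" "\<And>x. x \<notin> K \<Longrightarrow> d\<psi> x = 0"
      "continuous_on UNIV \<psi>" "continuous_on UNIV d\<psi>"
      using test_functionD[OF t] by metis
    have dc: "continuous_on UNIV (\<lambda>x. d\<psi> x $ i)" using K by (intro continuous_intros)
    have 1: "integrable (lebesgue_on \<Omega>) (\<lambda>x. f x * d\<psi> x $ i)" if "locally_integrable \<Omega> f" for f
      using integrable_test[OF \<Omega> that dc K(1,2)] K(4) by (simp add: mult.commute)
    have 2: "integrable (lebesgue_on \<Omega>) (\<lambda>x. F x $ i * \<psi> x)" if "locally_integrable \<Omega> F" for F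
      using integrable_test[OF \<Omega> locally_integrable_component[OF that] K(5,1,2)] K(3) by (simp add: mult.commute)
    have "(LINT x|lebesgue_on \<Omega>. u x * d\<psi> x $ i) = - (LINT x|lebesgue_on \<Omega>. U x $ i * \<psi> x)"
         "(LINT x|lebesgue_on \<Omega>. w x * d\<psi> x $ i) = - (LINT x|lebesgue_on \<Omega>. W x $ i * \<psi> x)"
      using loc t by auto
    then show "(LINT x|lebesgue_on \<Omega>. (u x - w x) * d\<psi> x $ i) = - (LINT x|lebesgue_on \<Omega>. (U x - W x) $ i * \<psi> x)"
      using loc by (simp add: left_diff_distrib 1 2)
  qed (use loc locally_integrable_diff in auto)
qed

lemma has_weak_grad_unique:
  fixes v :: "real^'n \<Rightarrow> real"
  assumes \<Omega>: "open \<Omega>" and "has_weak_grad \<Omega> v G1" "has_weak_grad \<Omega> v G2"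
  shows "AE x in lebesgue_on \<Omega>. G1 x = G2 x"
proof -
  define G where "G x = G1 x - G2 x" for x
  have G: "has_weak_grad \<Omega> (\<lambda>x. v x - v x) G"
    unfolding G_def using has_weak_grad_diff assms by blast
  then have Gl: "locally_integrable \<Omega> G" by (simp add: has_weak_grad_def)
  have ball: "negligible {x \<in> ball a r. G x $ i \<noteq> 0}" if r: "r > 0" "cball a r \<subseteq> \<Omega>" for a r i
  proof -
    have Gi: "locally_integrable \<Omega> (\<lambda>x. G x $ i)" by (rule locally_integrable_component[OF Gl])
    have S: "cball a r \<in> sets lebesgue" by simp
    \<comment> \<open>Lets integrals switch between \<open>\<Omega>\<close>, where the weak identity
      lives, and the compact ball, where polynomials are dense.\<close>
    have on_ball: "indicator (cball a r) x *\<^sub>R (c * (bump a r x * d)) = indicator \<Omega> x *\<^sub>R (c * (bump a r x * d))"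
      for x c d
      using r bump_eq_0[of r x a] by (auto simp: indicator_def)
    \<comment> \<open>The bump is counted as part of the function rather than of the test function;
      it can be divided out afterwards because it is positive on the open ball.\<close>
    have "negligible {x \<in> cball a r. bump a r x * G x $ i \<noteq> 0}"
    proof (rule negligible_if_polynomial_integrals_zero)
      have "integrable (lebesgue_on \<Omega>) (\<lambda>x. bump a r x *\<^sub>R G x $ i)"
      proof (rule integrable_test[OF \<Omega> Gi continuous_on_bump compact_cball r(2)])
        show "bump a r x = 0" if "x \<notin> cball a r" for x
          using bump_eq_0[OF r(1), of x a] that by simp
      qed
      then have "integrable lebesgue (\<lambda>x. indicator \<Omega> x *\<^sub>R (1 * (bump a r x * G x $ i)))"
        using \<Omega> by (simp add: integrable_restrict_space)
      then show "integrable (lebesgue_on (cball a r)) (\<lambda>x. bump a r x * G x $ i)"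
        unfolding on_ball[symmetric] by (simp add: integrable_restrict_space S)
      fix p :: "real^'n \<Rightarrow> real" assume "real_polynomial_function p"
      then obtain d\<psi> where "test_function \<Omega> (\<lambda>x. bump a r x * p x) d\<psi>"
        using test_function_bump_mult r by blast
      then have "(LINT x|lebesgue_on \<Omega>. (v x - v x) * d\<psi> x $ i)
          = - (LINT x|lebesgue_on \<Omega>. G x $ i * (bump a r x * p x))"
        using G unfolding has_weak_grad_def by blast
      then have "(LINT x|lebesgue_on \<Omega>. G x $ i * (bump a r x * p x)) = 0"
        by simp
      then have "(LINT x|lebesgue. indicator \<Omega> x *\<^sub>R (G x $ i * (bump a r x * p x))) = 0"
        using \<Omega> by (simp add: integral_restrict_space)
      then show "(LINT x|lebesgue_on (cball a r). p x * (bump a r x * G x $ i)) = 0"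
        unfolding on_ball[symmetric] by (simp add: integral_restrict_space S mult_ac)
    qed simp
    then show ?thesis
      by (rule negligible_subset) (use bump_pos_iff[OF r(1), of a] in force)
  qed
  have "negligible {x \<in> \<Omega>. G x $ i \<noteq> 0}" for i
  \<comment> \<open>Nullity is a local property, so the balls need not be organised into a countable
    cover.\<close>
  proof (subst locally_negligible_alt, rule ballI)
    fix x assume x: "x \<in> {x \<in> \<Omega>. G x $ i \<noteq> 0}"
    then obtain r where r: "r > 0" "cball x r \<subseteq> \<Omega>"
      using \<Omega> open_contains_cball by blast
    show "\<exists>U. openin (top_of_set {x \<in> \<Omega>. G x $ i \<noteq> 0}) U \<and> x \<in> U \<and> negligible U"
      by (rule exI[of _ "{x \<in> \<Omega>. G x $ i \<noteq> 0} \<inter> ball x r"], intro conjI openin_open_Int)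
         (use x r in \<open>auto intro: negligible_subset[OF ball[OF r]]\<close>)
  qed
  then have "negligible (\<Union>i. {x \<in> \<Omega>. G x $ i \<noteq> 0})"
    by (intro negligible_Union) auto
  moreover have "(\<Union>i. {x \<in> \<Omega>. G x $ i \<noteq> 0}) = {x \<in> \<Omega>. G1 x \<noteq> G2 x}"
    by (auto simp: G_def vec_eq_iff)
  ultimately have "AE x in lebesgue. x \<in> \<Omega> \<longrightarrow> G1 x = G2 x"
    by (auto simp: eventually_ae_filter negligible_iff_null_sets)
  then show ?thesis
    using \<Omega> by (simp add: AE_restrict_space_iff)
qed


section \<open>Existence of a bounded weak gradient\<close>

lemma locally_integrable_bounded:
  fixes F :: "real^'n \<Rightarrow> 'b::euclidean_space"
  assumes \<Omega>: "open \<Omega>" and F: "F \<in> borel_measurable (lebesgue_on \<Omega>)"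
    and B: "AE x in lebesgue_on \<Omega>. norm (F x) \<le> B"
  shows "locally_integrable \<Omega> F"
  unfolding locally_integrable_def set_integrable_def
proof (intro allI impI)
  fix K assume K: "compact K \<and> K \<subseteq> \<Omega>"
  have "integrable lebesgue (\<lambda>x. indicator K x *\<^sub>R (indicator \<Omega> x *\<^sub>R F x))"
  proof (rule integrableI_bounded_set_indicator)
    show "(\<lambda>x. indicator \<Omega> x *\<^sub>R F x) \<in> borel_measurable lebesgue"
      using \<Omega> F by (subst (asm) borel_measurable_restrict_space_iff) auto
    show "K \<in> sets lebesgue" using K by (simp add: compact_imp_closed)
    show "emeasure lebesgue K < \<infinity>"
      using K emeasure_compact_finite[of K] by (simp add: compact_imp_closed)
    have "AE x in lebesgue. x \<in> \<Omega> \<longrightarrow> norm (F x) \<le> B"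
      using B \<Omega> by (simp add: AE_restrict_space_iff)
    then show "AE x in lebesgue. x \<in> K \<longrightarrow> norm (indicator \<Omega> x *\<^sub>R F x) \<le> B"
      by eventually_elim (use K in auto)
  qed
  also have "(\<lambda>x. indicator K x *\<^sub>R (indicator \<Omega> x *\<^sub>R F x)) = (\<lambda>x. indicator K x *\<^sub>R F x)"
    using K by (auto simp: indicator_def fun_eq_iff)
  finally show "integrable lebesgue (\<lambda>x. indicator K x *\<^sub>R F x)" .
qed

text \<open>A sequence of step sizes instead of a continuous parameter: measurability of limits and
  dominated convergence are statements about sequences.\<close>

lemma difference_quotient_tendsto:
  fixes f :: "'a::real_normed_vector \<Rightarrow> real"
  assumes f: "(f has_derivative D) (at x)"
  shows "(\<lambda>n. (f (x + inverse (real (Suc n)) *\<^sub>R e) - f x) * real (Suc n)) \<longlonglongrightarrow> D e"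
proof -
  have "((\<lambda>t. x + t *\<^sub>R e) has_derivative (\<lambda>t. t *\<^sub>R e)) (at 0)"
    by (auto intro!: derivative_eq_intros)
  then have "((\<lambda>t. f (x + t *\<^sub>R e)) has_derivative (\<lambda>t. D (t *\<^sub>R e))) (at 0)"
    using f by (auto intro: has_derivative_compose[where x = 0])
  also have "(\<lambda>t. D (t *\<^sub>R e)) = (*) (D e)"
    using has_derivative_linear[OF f] by (auto simp: fun_eq_iff linear_cmul)
  finally have "((\<lambda>t. f (x + t *\<^sub>R e)) has_real_derivative D e) (at 0)"
    by (simp add: has_field_derivative_def)
  then have lim: "((\<lambda>t. (f (x + t *\<^sub>R e) - f x) / t) \<longlongrightarrow> D e) (at 0)"
    by (simp add: DERIV_def)
  have "filterlim (\<lambda>n. inverse (real (Suc n))) (at 0) sequentially"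
    using LIMSEQ_inverse_real_of_nat by (simp add: filterlim_at)
  from filterlim_compose[OF lim this] show ?thesis
    by (simp add: divide_inverse)
qed

lemma lborel_translate:
  fixes f :: "'a::euclidean_space \<Rightarrow> real"
  assumes "integrable lborel f"
  shows "integrable lborel (\<lambda>x. f (x + c))" "(LINT x|lborel. f (x + c)) = (LINT x|lborel. f x)"
proof -
  have f: "integrable (distr lborel borel ((+) c)) f" "f \<in> borel_measurable borel"
    using assms by (auto simp: lborel_distr_plus)
  then show "integrable lborel (\<lambda>x. f (x + c))"
    by (subst (asm) integrable_distr_eq) (auto simp: add.commute)
  have "(LINT x|lborel. f x) = (LINT x|distr lborel borel ((+) c). f x)"
    by (simp add: lborel_distr_plus)
  also have "\<dots> = (LINT x|lborel. f (x + c))"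
    using f by (subst integral_distr) (auto simp: add.commute)
  finally show "(LINT x|lborel. f (x + c)) = (LINT x|lborel. f x)" by simp
qed

lemma GDERIV_bounded_lipschitz:
  fixes \<psi> :: "'a::real_inner \<Rightarrow> real"
  assumes "\<And>x. GDERIV \<psi> x :> d\<psi> x" "\<And>x. norm (d\<psi> x) \<le> B"
  shows "\<bar>\<psi> x - \<psi> y\<bar> \<le> B * norm (x - y)"
proof -
  have "norm (\<psi> x - \<psi> y) \<le> B * norm (x - y)"
  proof (rule differentiable_bound[of UNIV])
    show "(\<psi> has_derivative (\<lambda>h. h \<bullet> d\<psi> z)) (at z within UNIV)" for z
      using assms(1)[of z] by (simp add: gderiv_def)
    show "onorm (\<lambda>h. h \<bullet> d\<psi> z) \<le> B" for z
    proof (rule onorm_bound)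
      show "0 \<le> B" using assms(2) norm_ge_zero order_trans by blast
      fix h
      have "\<bar>h \<bullet> d\<psi> z\<bar> \<le> norm h * norm (d\<psi> z)" by (rule Cauchy_Schwarz_ineq2)
      also have "\<dots> \<le> norm h * B" using assms(2) by (simp add: mult_left_mono)
      finally show "norm (h \<bullet> d\<psi> z) \<le> B * norm h" by (simp add: mult.commute)
    qed
  qed auto
  then show ?thesis by simp
qed

text \<open>Integration by parts from translation invariance: the difference quotients of
  \<open>u \<psi>\<close> integrate to zero and converge boundedly.\<close>

lemma ex_bounded_weak_grad:
  fixes u :: "real^'n \<Rightarrow> real"
  assumes \<Omega>: "open \<Omega>" and cont: "continuous_on \<Omega> u" and B: "\<And>x. x \<in> \<Omega> \<Longrightarrow> \<bar>u x\<bar> \<le> B"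
    and L: "0 \<le> L" "\<And>x y. closed_segment x y \<subseteq> \<Omega> \<Longrightarrow> \<bar>u x - u y\<bar> \<le> L * norm (x - y)"
    and diff: "negligible {x \<in> \<Omega>. \<not> u differentiable (at x)}"
  shows "\<exists>G M. has_weak_grad \<Omega> u G \<and> G \<in> borel_measurable (lebesgue_on \<Omega>) \<and>
    (AE x in lebesgue_on \<Omega>. norm (G x) \<le> M)"
proof -
  \<comment> \<open>Extension by zero gives a Borel function on the whole space, whose translates
    make sense everywhere.\<close>
  define u0 where "u0 x = indicator \<Omega> x *\<^sub>R u x" for x
  define h where "h n = inverse (real (Suc n))" for n
  have h: "0 < h n" "h n \<le> 1" for n
    by (auto simp: h_def inverse_le_1_iff)
  have h_Suc: "c * h n * real (Suc n) = c" for c n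
    by (simp add: h_def)
  \<comment> \<open>Written as a sequential \<open>lim\<close> of Borel functions, \<open>G\<close>
    is Borel even though the limit may fail to exist; inside \<open>\<Omega>\<close> this happens
    only on a null set.\<close>
  define G where "G x = (\<chi> i. lim (\<lambda>n. (u0 (x + h n *\<^sub>R axis i 1) - u0 x) * real (Suc n)))" for x
  have u0[measurable]: "u0 \<in> borel_measurable borel"
    unfolding u0_def using \<Omega> cont by (intro borel_measurable_continuous_on_indicator) auto
  have Gi[measurable]: "(\<lambda>x. G x $ i) \<in> borel_measurable borel" for i
    unfolding G_def by simp
  have G: "G \<in> borel_measurable borel"
    by (subst borel_measurable_euclidean_space) (auto simp: Basis_vec_def inner_axis intro: Gi)
  have Gm: "G \<in> borel_measurable (lebesgue_on \<Omega>)"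
    using G by (intro measurable_restrict_space1 measurable_completion) simp
  have u0_deriv: "(u0 has_derivative D) (at x)" if "x \<in> \<Omega>" "(u has_derivative D) (at x)" for x D
    using that(2) by (rule has_derivative_transform_within_open[where s = \<Omega>])
      (use \<Omega> that in \<open>auto simp: u0_def\<close>)
  have G_eq: "G x $ i = D (axis i 1)" if "x \<in> \<Omega>" "(u has_derivative D) (at x)" for x i D
    using difference_quotient_tendsto[OF u0_deriv[OF that], of "axis i 1"]
    by (simp add: G_def h_def limI)
  have G_le: "\<bar>G x $ i\<bar> \<le> L" if x: "x \<in> \<Omega>" "u differentiable (at x)" for x i
  proof -
    obtain D where D: "(u has_derivative D) (at x)" using x unfolding differentiable_def by blast
    obtain r where r: "r > 0" "ball x r \<subseteq> \<Omega>" using \<Omega> x openE by blast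
    have lim: "(\<lambda>n. (u0 (x + h n *\<^sub>R axis i 1) - u0 x) * real (Suc n)) \<longlonglongrightarrow> G x $ i"
      using difference_quotient_tendsto[OF u0_deriv[OF x(1) D], of "axis i 1"] G_eq[OF x(1) D]
      by (simp add: h_def)
    have "\<forall>\<^sub>F n in sequentially. h n < r"
      using order_tendstoD(2)[OF LIMSEQ_inverse_real_of_nat r(1)] by (simp add: h_def)
    then have "\<forall>\<^sub>F n in sequentially. \<bar>(u0 (x + h n *\<^sub>R axis i 1) - u0 x) * real (Suc n)\<bar> \<le> L"
    proof eventually_elim
      fix n assume n: "h n < r"
      let ?y = "x + h n *\<^sub>R axis i 1"
      have y: "?y \<in> ball x r" using n h[of n] by (simp add: dist_norm)
      then have seg: "closed_segment ?y x \<subseteq> \<Omega>"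
        using r closed_segment_subset[OF y, of x] by auto
      have "\<bar>u ?y - u x\<bar> \<le> L * norm (?y - x)" by (rule L(2)[OF seg])
      also have "\<dots> = L * h n" using h[of n] by simp
      finally have "\<bar>u0 ?y - u0 x\<bar> \<le> L * h n" using y r x by (auto simp: u0_def)
      then have "\<bar>u0 ?y - u0 x\<bar> * real (Suc n) \<le> L * h n * real (Suc n)"
        by (rule mult_right_mono) simp
      then show "\<bar>(u0 ?y - u0 x) * real (Suc n)\<bar> \<le> L"
        by (simp only: abs_mult abs_of_nat h_Suc)
    qed
    then show ?thesis
      using tendsto_upperbound[OF tendsto_rabs[OF lim]] by simp
  qed
  have AE_diff: "AE x in lborel. x \<in> \<Omega> \<longrightarrow> u differentiable (at x)"
  proof -
    have "AE x in lebesgue. x \<in> \<Omega> \<longrightarrow> u differentiable (at x)"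
      using diff by (auto simp: eventually_ae_filter negligible_iff_null_sets)
    then show ?thesis by (simp add: AE_completion_iff)
  qed
  have AE_G: "AE x in lebesgue_on \<Omega>. norm (G x) \<le> real CARD('n) * L"
  proof -
    have "AE x in lebesgue. x \<in> \<Omega> \<longrightarrow> norm (G x) \<le> real CARD('n) * L"
      using AE_completion[OF AE_diff]
    proof eventually_elim
      case (elim x)
      show ?case
      proof
        assume "x \<in> \<Omega>"
        have "norm (G x) \<le> (\<Sum>i\<in>UNIV. \<bar>G x $ i\<bar>)" by (rule norm_le_l1_cart)
        also have "\<dots> \<le> (\<Sum>i\<in>(UNIV::'n set). L)" using G_le elim \<open>x \<in> \<Omega>\<close> by (intro sum_mono) auto
        finally show "norm (G x) \<le> real CARD('n) * L" by simp
      qed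
    qed
    then show ?thesis using \<Omega> by (simp add: AE_restrict_space_iff)
  qed
  have "locally_integrable \<Omega> u"
    using \<Omega> B cont by (intro locally_integrable_bounded[where B = B] continuous_imp_measurable_on_sets_lebesgue AE_I2)
      (auto simp: space_restrict_space)
  moreover have "locally_integrable \<Omega> G"
    using locally_integrable_bounded[OF \<Omega> Gm AE_G] .
  moreover have "(LINT x|lebesgue_on \<Omega>. u x * d\<psi> x $ i) = - (LINT x|lebesgue_on \<Omega>. G x $ i * \<psi> x)"
    if t: "test_function \<Omega> \<psi> d\<psi>" for \<psi> d\<psi> i
  proof -
    obtain K where K: "compact K" "K \<subseteq> \<Omega>" "\<And>x. x \<notin> K \<Longrightarrow> \<psi> x = 0" "\<And>x. x \<notin> K \<Longrightarrow> d\<psi> x = 0"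
      "continuous_on UNIV \<psi>" "continuous_on UNIV d\<psi>" "\<And>x. GDERIV \<psi> x :> d\<psi> x"
      using test_functionD[OF t] by metis
    obtain P where P: "P \<ge> 0" "\<And>x. \<bar>\<psi> x\<bar> \<le> P"
      using compact_support_bounded[OF K(5,1,3)] by auto
    obtain Q where Q: "Q \<ge> 0" "\<And>x. norm (d\<psi> x) \<le> Q"
      using compact_support_bounded[OF K(6,1,4)] by auto
    have [measurable]: "\<psi> \<in> borel_measurable borel" "(\<lambda>x. d\<psi> x $ i) \<in> borel_measurable borel"
      using K by (auto intro!: borel_measurable_continuous_onI continuous_intros)
    define e :: "real^'n" where "e = axis i 1"
    have e: "norm e = 1" by (simp add: e_def)
    define f where "f x = u0 x * \<psi> x" for x
    have [measurable]: "f \<in> borel_measurable borel" unfolding f_def by measurable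
    have B0: "\<bar>u0 x\<bar> \<le> max B 0" for x
      using B[of x] by (auto simp: u0_def indicator_def)
    have Kb: "K \<in> sets lborel" "emeasure lborel K < \<infinity>"
      using emeasure_compact_finite[OF K(1)] K(1) by (auto simp: compact_imp_closed)
    have intK: "integrable lborel w" if "w \<in> borel_measurable borel"
      "AE x in lborel. \<bar>w x\<bar> \<le> W" "\<And>x. x \<notin> K \<Longrightarrow> w x = 0" for w :: "real^'n \<Rightarrow> real" and W
      using that(2) by (intro integrableI_bounded_set[OF Kb(1) _ Kb(2), of w W]) (use that in auto)
    have fint: "integrable lborel f"
    proof (rule intK)
      show "AE x in lborel. \<bar>f x\<bar> \<le> max B 0 * P"
        unfolding f_def abs_mult using B0 P by (intro AE_I2 mult_mono) auto
    qed (auto simp: f_def K)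
    \<comment> \<open>The bound by \<open>L\<close> is available only along segments inside
      \<open>\<Omega>\<close>. Shifts below \<open>\<delta>\<close> stay inside when they start or
      end in \<open>K\<close>; the index \<open>N\<close> discards the larger ones.\<close>
    obtain \<delta> where \<delta>: "\<delta> > 0" "(\<Union>x\<in>K. ball x \<delta>) \<subseteq> \<Omega>"
      using compact_subset_open_imp_ball_epsilon_subset[OF K(1) \<Omega> K(2)] by blast
    obtain N where N: "\<And>n. n \<ge> N \<Longrightarrow> h n < \<delta>"
      using order_tendstoD(2)[OF LIMSEQ_inverse_real_of_nat \<delta>(1)]
      unfolding h_def eventually_sequentially by blast
    define q where "q n x = (f (x + h (n + N) *\<^sub>R e) - f x) * real (Suc (n + N))" for n x
    \<comment> \<open>All shifts have length at most 1, so this compact set contains the support of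
      every difference quotient of \<open>f\<close> and gives an integrable majorant.\<close>
    define K' where "K' = {x + y | x y. x \<in> K \<and> y \<in> cball 0 1}"
    have K': "compact K'" unfolding K'_def using K(1) by (intro compact_sums) auto
    have K'I: "x + y \<in> K'" if "x \<in> K" "norm y \<le> 1" for x y
      unfolding K'_def using that by auto
    \<comment> \<open>The Lipschitz bound of a product: bound of \<open>u0\<close> times slope of
      \<open>\<psi>\<close>, plus bound of \<open>\<psi>\<close> times slope of
      \<open>u\<close>.\<close>
    define M where "M = max B 0 * Q + P * L"
    have q_le: "\<bar>q n x\<bar> \<le> M * indicator K' x" for n x
    proof -
      let ?h = "h (n + N)" let ?y = "x + ?h *\<^sub>R e"
      have hh: "0 < ?h" "?h \<le> 1" "?h < \<delta>" using h N by auto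
      show ?thesis
      proof (cases "x \<in> K \<or> ?y \<in> K")
        case False
        then show ?thesis using P(1) Q(1) L(1) by (simp add: q_def f_def K M_def)
      next
        case True
        \<comment> \<open>Both end points lie in one ball, which is convex and contained in
          \<open>\<Omega>\<close>, hence so is the segment between them.\<close>
        have sub: "\<exists>z\<in>K. x \<in> ball z \<delta> \<and> ?y \<in> ball z \<delta>"
          using True
        proof
          assume "x \<in> K"
          then show ?thesis using hh e \<delta>(1) by (intro bexI[of _ x]) (auto simp: dist_norm)
        next
          assume "?y \<in> K"
          then show ?thesis using hh e \<delta>(1) by (intro bexI[of _ ?y]) (auto simp: dist_norm)
        qed
        then have seg: "closed_segment ?y x \<subseteq> \<Omega>"
          using \<delta>(2) by (meson UN_upper closed_segment_subset convex_ball subset_trans)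
        have "x \<in> K'"
          using True
        proof
          assume "x \<in> K"
          then show ?thesis using K'I[of x 0] by simp
        next
          assume "?y \<in> K"
          then show ?thesis using K'I[of ?y "- (?h *\<^sub>R e)"] hh e by simp
        qed
        have \<Omega>xy: "x \<in> \<Omega>" "?y \<in> \<Omega>" using seg by auto
        have "\<bar>u ?y - u x\<bar> \<le> L * ?h"
          using L(2)[OF seg] hh e by simp
        moreover have "\<bar>\<psi> ?y - \<psi> x\<bar> \<le> Q * ?h"
          using GDERIV_bounded_lipschitz[OF K(7) Q(2), of ?y x] hh e by simp
        ultimately have "\<bar>u0 ?y * (\<psi> ?y - \<psi> x)\<bar> + \<bar>\<psi> x * (u ?y - u x)\<bar> \<le> max B 0 * (Q * ?h) + P * (L * ?h)"
          unfolding abs_mult using B0 P by (intro add_mono mult_mono) auto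
        moreover have "f ?y - f x = u0 ?y * (\<psi> ?y - \<psi> x) + \<psi> x * (u ?y - u x)"
          using \<Omega>xy by (simp add: f_def u0_def algebra_simps)
        ultimately have "\<bar>f ?y - f x\<bar> \<le> max B 0 * (Q * ?h) + P * (L * ?h)"
          by linarith
        also have "\<dots> = M * ?h"
          by (simp add: M_def algebra_simps)
        finally have "\<bar>f ?y - f x\<bar> \<le> M * ?h" .
        then have "\<bar>f ?y - f x\<bar> * real (Suc (n + N)) \<le> M * ?h * real (Suc (n + N))"
          by (rule mult_right_mono) simp
        then show ?thesis
          using \<open>x \<in> K'\<close> unfolding q_def abs_mult abs_of_nat h_Suc by simp
      qed
    qed
    have q_lim: "(\<lambda>n. q n x) \<longlonglongrightarrow> u0 x * d\<psi> x $ i + G x $ i * \<psi> x"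
      if "x \<in> \<Omega> \<longrightarrow> u differentiable (at x)" for x
    proof -
      have "\<exists>D. (f has_derivative D) (at x) \<and> D e = u0 x * d\<psi> x $ i + G x $ i * \<psi> x"
      proof (cases "x \<in> \<Omega>")
        case True
        then obtain D where D: "(u has_derivative D) (at x)"
          using \<open>x \<in> \<Omega> \<longrightarrow> u differentiable (at x)\<close> unfolding differentiable_def by blast
        have "(f has_derivative (\<lambda>h. u0 x * (h \<bullet> d\<psi> x) + D h * \<psi> x)) (at x)"
          unfolding f_def using u0_deriv[OF True D] K(7)[of x]
          by (intro has_derivative_mult) (simp_all add: gderiv_def)
        moreover have "u0 x * (e \<bullet> d\<psi> x) + D e * \<psi> x = u0 x * d\<psi> x $ i + G x $ i * \<psi> x"
          using G_eq[OF True D] by (simp add: e_def inner_axis')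
        ultimately show ?thesis by blast
      next
        case False
        \<comment> \<open>Outside \<open>\<Omega>\<close>, in particular on its boundary where
          \<open>u0\<close> may jump, \<open>f\<close> still vanishes in a neighbourhood, since the
          complement of \<open>K\<close> is open.\<close>
        then have x: "x \<notin> K" using K(2) by blast
        have "((\<lambda>x. 0) has_derivative (\<lambda>h. 0)) (at x)" by simp
        then have "(f has_derivative (\<lambda>h. 0)) (at x)"
          by (rule has_derivative_transform_within_open[where s = "- K"])
             (use x K(1) in \<open>auto simp: f_def K(3) compact_imp_closed\<close>)
        then show ?thesis using x K by auto
      qed
      then obtain D where D: "(f has_derivative D) (at x)" "D e = u0 x * d\<psi> x $ i + G x $ i * \<psi> x"
        by blast
      show ?thesis
        using LIMSEQ_ignore_initial_segment[OF difference_quotient_tendsto[OF D(1), of e], of N] D(2)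
        by (simp add: q_def h_def)
    qed
    have "(\<lambda>n. LINT x|lborel. q n x) \<longlonglongrightarrow> (LINT x|lborel. u0 x * d\<psi> x $ i + G x $ i * \<psi> x)"
    proof (rule integral_dominated_convergence[where w = "\<lambda>x. M * indicator K' x"])
      show "integrable lborel (\<lambda>x. M * indicator K' x)"
        using K' by (intro integrable_mult_right integrable_real_indicator)
          (use emeasure_compact_finite[OF K'] in \<open>auto simp: compact_imp_closed\<close>)
      show "AE x in lborel. (\<lambda>n. q n x) \<longlonglongrightarrow> u0 x * d\<psi> x $ i + G x $ i * \<psi> x"
        using AE_diff by eventually_elim (rule q_lim)
    qed (use q_le in \<open>auto simp: q_def\<close>)
    moreover have "(LINT x|lborel. q n x) = 0" for n
      unfolding q_def using lborel_translate[OF fint] fint by simp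
    ultimately have "(LINT x|lborel. u0 x * d\<psi> x $ i + G x $ i * \<psi> x) = 0"
      by (simp add: LIMSEQ_const_iff)
    moreover have "integrable lborel (\<lambda>x. u0 x * d\<psi> x $ i)"
    proof (rule intK)
      have "\<bar>d\<psi> x $ i\<bar> \<le> Q" for x
        using Q(2)[of x] component_le_norm_cart order_trans by blast
      then show "AE x in lborel. \<bar>u0 x * d\<psi> x $ i\<bar> \<le> max B 0 * Q"
        unfolding abs_mult using B0 by (intro AE_I2 mult_mono) auto
    qed (auto simp: K)
    moreover have "integrable lborel (\<lambda>x. G x $ i * \<psi> x)"
    proof (rule intK)
      show "AE x in lborel. \<bar>G x $ i * \<psi> x\<bar> \<le> L * P"
        using AE_diff
      proof eventually_elim
        case (elim x)
        show ?case
        proof (cases "x \<in> \<Omega>")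
          case True
          then show ?thesis unfolding abs_mult using G_le elim P L(1) by (intro mult_mono) auto
        next
          case False
          then have "\<psi> x = 0" using K by blast
          then show ?thesis using P(1) L(1) by simp
        qed
      qed
    qed (auto simp: K)
    ultimately have "(LINT x|lborel. u0 x * d\<psi> x $ i) = - (LINT x|lborel. G x $ i * \<psi> x)"
      by simp
    \<comment> \<open>The argument ran over \<open>lborel\<close> for the sake of translation
      invariance. The zero extension here, and the support of \<open>\<psi>\<close> in the companion
      identity, lead back to integrals over \<open>\<Omega>\<close>.\<close>
    moreover have "(LINT x|lebesgue_on \<Omega>. u x * d\<psi> x $ i) = (LINT x|lborel. u0 x * d\<psi> x $ i)"
    proof -
      have "(LINT x|lebesgue_on \<Omega>. u x * d\<psi> x $ i) = (LINT x|lebesgue. indicator \<Omega> x *\<^sub>R (u x * d\<psi> x $ i))"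
        using \<Omega> by (simp add: integral_restrict_space)
      also have "(\<lambda>x. indicator \<Omega> x *\<^sub>R (u x * d\<psi> x $ i)) = (\<lambda>x. u0 x * d\<psi> x $ i)"
        by (simp add: u0_def fun_eq_iff mult.assoc)
      also have "(LINT x|lebesgue. u0 x * d\<psi> x $ i) = (LINT x|lborel. u0 x * d\<psi> x $ i)"
        by (rule integral_completion) simp
      finally show ?thesis .
    qed
    moreover have "(LINT x|lebesgue_on \<Omega>. G x $ i * \<psi> x) = (LINT x|lborel. G x $ i * \<psi> x)"
    proof -
      have "(LINT x|lebesgue_on \<Omega>. G x $ i * \<psi> x) = (LINT x|lebesgue. indicator \<Omega> x *\<^sub>R (G x $ i * \<psi> x))"
        using \<Omega> by (simp add: integral_restrict_space)
      also have "(\<lambda>x. indicator \<Omega> x *\<^sub>R (G x $ i * \<psi> x)) = (\<lambda>x. G x $ i * \<psi> x)"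
        using K(2,3) by (auto simp: indicator_def fun_eq_iff)
      also have "(LINT x|lebesgue. G x $ i * \<psi> x) = (LINT x|lborel. G x $ i * \<psi> x)"
        by (rule integral_completion) simp
      finally show ?thesis .
    qed
    ultimately show ?thesis by simp
  qed
  ultimately show ?thesis
    using Gm AE_G unfolding has_weak_grad_def by blast
qed


subsection \<open>Finite element functions\<close>

lemma poly_deg_le_imp_polynomial:
  fixes p :: "real^'n \<Rightarrow> real"
  assumes "poly_deg_le j p"
  shows "real_polynomial_function p"
proof -
  let ?A = "{\<alpha>. (\<Sum>i\<in>(UNIV::'n set). \<alpha> i) \<le> j}"
  obtain c where c: "\<forall>x. p x = (\<Sum>\<alpha>\<in>?A. c \<alpha> * (\<Prod>i\<in>UNIV. (x $ i) ^ \<alpha> i))"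
    using assms unfolding poly_deg_le_def by (elim exE)
  have comp: "real_polynomial_function (\<lambda>x::real^'n. x $ i)" for i
    by (intro real_polynomial_function.intros(1) bounded_linear_vec_nth)
  have "real_polynomial_function (\<lambda>x. \<Sum>\<alpha>\<in>?A. c \<alpha> * (\<Prod>i\<in>UNIV. (x $ i) ^ \<alpha> i))"
  \<comment> \<open>An infinite index set would make the sum 0 by convention, which is again a
    polynomial; the case split replaces a proof that the set of multi-indices is finite.\<close>
  proof (cases "finite ?A")
    case True
    then show ?thesis
      by (intro real_polynomial_function_sum real_polynomial_function.intros(4) real_polynomial_function.intros(2)
          real_polynomial_function_prod real_polynomial_function_power comp) auto
  next
    case False
    then show ?thesis by (simp add: real_polynomial_function.intros(2))
  qed
  moreover have "p = (\<lambda>x. \<Sum>\<alpha>\<in>?A. c \<alpha> * (\<Prod>i\<in>UNIV. (x $ i) ^ \<alpha> i))"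
    using c by (intro ext) (rule spec)
  ultimately show ?thesis by (simp only:)
qed

lemma poly_deg_le_diff:
  fixes p q :: "real^'n \<Rightarrow> real"
  assumes "poly_deg_le j p" "poly_deg_le j q"
  shows "poly_deg_le j (\<lambda>x. p x - q x)"
proof -
  let ?A = "{\<alpha>. (\<Sum>i\<in>(UNIV::'n set). \<alpha> i) \<le> j}"
  obtain c where c: "\<forall>x. p x = (\<Sum>\<alpha>\<in>?A. c \<alpha> * (\<Prod>i\<in>UNIV. (x $ i) ^ \<alpha> i))"
    using assms unfolding poly_deg_le_def by (elim exE)
  obtain d where d: "\<forall>x. q x = (\<Sum>\<alpha>\<in>?A. d \<alpha> * (\<Prod>i\<in>UNIV. (x $ i) ^ \<alpha> i))"
    using assms unfolding poly_deg_le_def by (elim exE)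
  show ?thesis
    unfolding poly_deg_le_def
    by (rule exI[of _ "\<lambda>\<alpha>. c \<alpha> - d \<alpha>"]) (simp add: c d sum_subtractf left_diff_distrib)
qed

text \<open>Makes the difference of the new phase field and the projected old one an admissible test
  function in the potential equation.\<close>

lemma FE_diff:
  assumes "u \<in> FE j \<Omega> \<T>" "w \<in> FE j \<Omega> \<T>"
  shows "(\<lambda>x. u x - w x) \<in> FE j \<Omega> \<T>"
  unfolding FE_def
proof (intro CollectI conjI ballI)
  show "continuous_on (closure \<Omega>) (\<lambda>x. u x - w x)"
    using assms by (auto simp: FE_def intro: continuous_on_diff)
  fix T assume T: "T \<in> \<T>"
  obtain p where "poly_deg_le j p" "\<forall>x\<in>T. u x = p x" using assms(1) T unfolding FE_def by blast
  moreover obtain r where "poly_deg_le j r" "\<forall>x\<in>T. w x = r x" using assms(2) T unfolding FE_def by blast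
  ultimately show "\<exists>p. poly_deg_le j p \<and> (\<forall>x\<in>T. u x - w x = p x)"
    by (intro exI[of _ "\<lambda>x. p x - r x"]) (simp add: poly_deg_le_diff)
qed

lemma polynomial_lipschitz_on_compact_convex:
  fixes p :: "'a::euclidean_space \<Rightarrow> real"
  assumes "real_polynomial_function p" "compact T" "convex T"
  shows "\<exists>L\<ge>0. \<forall>x\<in>T. \<forall>y\<in>T. \<bar>p x - p y\<bar> \<le> L * norm (x - y)"
proof -
  obtain dp where dp: "\<forall>x. GDERIV p x :> dp x" "continuous_on UNIV dp"
    using real_polynomial_function_C1[OF assms(1)] by blast
  have "compact (dp ` T)"
    using dp(2) assms(2) by (meson compact_continuous_image continuous_on_subset subset_UNIV)
  then obtain L where L: "\<forall>x\<in>T. norm (dp x) \<le> L"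
    using compact_imp_bounded[of "dp ` T"] by (auto simp: bounded_iff)
  have "norm (p x - p y) \<le> max 0 L * norm (x - y)" if "x \<in> T" "y \<in> T" for x y
  proof (rule differentiable_bound[OF assms(3)])
    fix z assume z: "z \<in> T"
    show "(p has_derivative (\<lambda>h. h \<bullet> dp z)) (at z within T)"
      using dp(1) by (simp add: gderiv_def has_derivative_at_withinI)
    show "onorm (\<lambda>h. h \<bullet> dp z) \<le> max 0 L"
    proof (rule onorm_bound)
      fix h
      have "\<bar>h \<bullet> dp z\<bar> \<le> norm h * norm (dp z)" by (rule Cauchy_Schwarz_ineq2)
      also have "\<dots> \<le> norm h * max 0 L" using L z by (intro mult_left_mono) (auto intro: max.coboundedI2)
      finally show "norm (h \<bullet> dp z) \<le> max 0 L * norm h" by (simp add: mult.commute)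
    qed simp
  qed (use that in auto)
  then show ?thesis by (intro exI[of _ "max 0 L"]) auto
qed

lemma meshD:
  assumes "mesh \<Omega> \<T>"
  shows "finite \<T>" "\<And>T. T \<in> \<T> \<Longrightarrow> compact T \<and> convex T" "\<Union>\<T> = closure \<Omega>"
  using assms simplex_imp_polytope polytope_imp_compact polytope_imp_convex
  unfolding mesh_def triangulation_def by blast+

text \<open>The Lipschitz bounds on the cells are glued together along segments in the domain, where the
  continuous function runs through finitely many closed cells.\<close>

lemma FE_lipschitz_on_segments:
  fixes u :: "real^'n \<Rightarrow> real"
  assumes mesh: "mesh \<Omega> \<T>" and u: "u \<in> FE j \<Omega> \<T>"
  shows "\<exists>L\<ge>0. \<forall>x y. closed_segment x y \<subseteq> \<Omega> \<longrightarrow> \<bar>u x - u y\<bar> \<le> L * norm (x - y)"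
proof -
  have "\<exists>L\<ge>0. \<forall>x\<in>T. \<forall>y\<in>T. \<bar>u x - u y\<bar> \<le> L * norm (x - y)" if T: "T \<in> \<T>" for T
  proof -
    obtain p where p: "poly_deg_le j p" "\<forall>x\<in>T. u x = p x" using u T unfolding FE_def by blast
    then show ?thesis
      using polynomial_lipschitz_on_compact_convex[OF poly_deg_le_imp_polynomial[OF p(1)], of T]
        meshD(2)[OF mesh T] by simp
  qed
  then obtain l where l: "\<And>T. T \<in> \<T> \<Longrightarrow> l T \<ge> 0"
    "\<And>T x y. T \<in> \<T> \<Longrightarrow> x \<in> T \<Longrightarrow> y \<in> T \<Longrightarrow> \<bar>u x - u y\<bar> \<le> l T * norm (x - y)"
    by metis
  \<comment> \<open>The sum serves merely as a common upper bound for the finitely many constants of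
    the cells.\<close>
  define L where "L = (\<Sum>T\<in>\<T>. l T)"
  have L: "L \<ge> 0" unfolding L_def using l(1) by (rule sum_nonneg)
  have lL: "l T \<le> L" if "T \<in> \<T>" for T
    unfolding L_def using that meshD(1)[OF mesh] l(1) by (intro member_le_sum) auto
  have "\<bar>u x - u y\<bar> \<le> L * norm (x - y)" if seg: "closed_segment x y \<subseteq> \<Omega>" for x y
  proof -
    define s where "s t = x + t *\<^sub>R (y - x)" for t :: real
    have s: "s t \<in> closed_segment x y" if "t \<in> {0..1}" for t
      using that unfolding s_def closed_segment_def by (auto simp: algebra_simps intro!: exI[of _ t])
    have sc: "continuous_on S s" for S unfolding s_def by (intro continuous_intros)
    \<comment> \<open>Pulled back to the unit interval, the cells become a finite closed cover, and
      a common Lipschitz constant on the pieces of such a cover holds on the interval.\<close>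
    have "lipschitz_on (L * norm (y - x)) {0..1} (\<lambda>t. u (s t))"
    proof (rule lipschitz_on_closed_Union[where U = "\<lambda>T. {0..1} \<inter> s -` T" and I = \<T>])
      fix T assume T: "T \<in> \<T>"
      show "lipschitz_on (L * norm (y - x)) ({0..1} \<inter> s -` T) (\<lambda>t. u (s t))"
      proof (rule lipschitz_onI)
        fix a b assume "a \<in> {0..1} \<inter> s -` T" "b \<in> {0..1} \<inter> s -` T"
        then have "\<bar>u (s a) - u (s b)\<bar> \<le> l T * norm (s a - s b)" using l(2)[OF T] by simp
        also have "s a - s b = (a - b) *\<^sub>R (y - x)" by (simp add: s_def algebra_simps)
        also have "l T * norm \<dots> \<le> L * norm \<dots>" using lL[OF T] by (rule mult_right_mono) simp
        finally show "dist (u (s a)) (u (s b)) \<le> L * norm (y - x) * dist a b"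
          by (simp add: dist_norm mult_ac)
      qed (use L in simp)
      show "closed ({0..1} \<inter> s -` T)"
        using sc meshD(2)[OF mesh T] by (intro continuous_closed_preimage) (auto intro: compact_imp_closed)
    next
      show "{0..1} \<subseteq> (\<Union>T\<in>\<T>. {0..1} \<inter> s -` T)"
        using s seg meshD(3)[OF mesh] closure_subset[of \<Omega>] by fastforce
    qed (use L meshD(1)[OF mesh] in auto)
    from lipschitz_onD[OF this, of 0 1] show ?thesis
      by (simp add: s_def dist_norm norm_minus_commute)
  qed
  with L show ?thesis by blast
qed

text \<open>In the interior of a cell the function agrees locally with a polynomial, and the
  frontiers of the cells are null because the cells are convex.\<close>

lemma FE_differentiable_ae:
  fixes u :: "real^'n \<Rightarrow> real"
  assumes mesh: "mesh \<Omega> \<T>" and u: "u \<in> FE j \<Omega> \<T>"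
  shows "negligible {x \<in> \<Omega>. \<not> u differentiable (at x)}"
proof (rule negligible_subset)
  show "negligible (\<Union>T\<in>\<T>. frontier T)"
    using meshD[OF mesh] by (intro negligible_Union) (auto intro: negligible_convex_frontier)
  show "{x \<in> \<Omega>. \<not> u differentiable (at x)} \<subseteq> (\<Union>T\<in>\<T>. frontier T)"
  proof
    fix x assume x: "x \<in> {x \<in> \<Omega>. \<not> u differentiable (at x)}"
    then obtain T where T: "T \<in> \<T>" "x \<in> T"
      using meshD(3)[OF mesh] closure_subset[of \<Omega>] by blast
    obtain p where p: "poly_deg_le j p" "\<forall>x\<in>T. u x = p x" using u T(1) unfolding FE_def by blast
    obtain dp where dp: "\<forall>x. GDERIV p x :> dp x"
      using real_polynomial_function_C1[OF poly_deg_le_imp_polynomial[OF p(1)]] by blast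
    have "x \<notin> interior T"
    proof
      assume xi: "x \<in> interior T"
      have "(p has_derivative (\<lambda>h. h \<bullet> dp x)) (at x)" using dp by (simp add: gderiv_def)
      then have "(u has_derivative (\<lambda>h. h \<bullet> dp x)) (at x)"
        by (rule has_derivative_transform_within_open[where s = "interior T"])
          (use xi p(2) interior_subset[of T] in \<open>auto simp: subset_iff\<close>)
      then show False using x by (auto simp: differentiable_def)
    qed
    then show "x \<in> (\<Union>T\<in>\<T>. frontier T)"
      using T meshD(2)[OF mesh T(1)] by (auto simp: frontier_def intro: closure_subset[THEN subsetD])
  qed
qed

section \<open>Essentially bounded functions and the weak gradient of finite element
  functions\<close>

definition ess_bounded :: "(real^'n) set \<Rightarrow> (real^'n \<Rightarrow> 'b::euclidean_space) \<Rightarrow> bool" where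
  "ess_bounded \<Omega> f \<longleftrightarrow> f \<in> borel_measurable (lebesgue_on \<Omega>) \<and> (\<exists>B. AE x in lebesgue_on \<Omega>. norm (f x) \<le> B)"

lemma ess_bounded_cont:
  fixes u :: "real^'n \<Rightarrow> 'b::euclidean_space"
  assumes "open \<Omega>" "bounded \<Omega>" "continuous_on (closure \<Omega>) u"
  shows "ess_bounded \<Omega> u"
proof -
  have "compact (u ` closure \<Omega>)"
    using assms by (intro compact_continuous_image) (auto simp: compact_closure)
  then obtain B where "\<forall>x\<in>closure \<Omega>. norm (u x) \<le> B"
    using compact_imp_bounded[of "u ` closure \<Omega>"] by (auto simp: bounded_iff)
  then have "AE x in lebesgue_on \<Omega>. norm (u x) \<le> B"
    using closure_subset[of \<Omega>] by (intro AE_I2) (auto simp: space_restrict_space)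
  moreover have "u \<in> borel_measurable (lebesgue_on \<Omega>)"
    using assms by (intro continuous_imp_measurable_on_sets_lebesgue continuous_on_subset[OF assms(3) closure_subset]) auto
  ultimately show ?thesis unfolding ess_bounded_def by blast
qed

lemma ess_bounded_integrable:
  assumes "open \<Omega>" "bounded \<Omega>" "ess_bounded \<Omega> f"
  shows "integrable (lebesgue_on \<Omega>) f"
proof -
  obtain B where B: "f \<in> borel_measurable (lebesgue_on \<Omega>)" "AE x in lebesgue_on \<Omega>. norm (f x) \<le> B"
    using assms(3) unfolding ess_bounded_def by blast
  have "emeasure lebesgue \<Omega> < \<infinity>"
    using emeasure_bounded_finite[OF assms(2)] assms(1) by simp
  then have "emeasure (lebesgue_on \<Omega>) \<Omega> < \<infinity>"
    using assms(1) by (simp add: emeasure_restrict_space)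
  then show ?thesis
    using B assms(1)
    by (intro integrableI_bounded_set[where A = \<Omega> and B = B] AE_I2[of _ "\<lambda>x. x \<notin> \<Omega> \<longrightarrow> f x = 0"])
      (auto simp: space_restrict_space sets_restrict_space_iff elim!: eventually_mono)
qed

text \<open>Existence makes the choice behind \<open>weak_grad\<close> a true weak gradient.
  Uniqueness then transfers measurability and the bound to it from the constructed gradient.\<close>

lemma FE_weak_grad:
  fixes u :: "real^'n \<Rightarrow> real"
  assumes \<Omega>: "open \<Omega>" "bounded \<Omega>" and mesh: "mesh \<Omega> \<T>" and u: "u \<in> FE j \<Omega> \<T>"
  shows "has_weak_grad \<Omega> u (weak_grad \<Omega> u)" "ess_bounded \<Omega> (weak_grad \<Omega> u)"
proof -
  have cont: "continuous_on \<Omega> u" and cl: "continuous_on (closure \<Omega>) u"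
    using u closure_subset[of \<Omega>] continuous_on_subset by (auto simp: FE_def)
  have "compact (u ` closure \<Omega>)"
    using \<Omega> cl by (intro compact_continuous_image) (auto simp: compact_closure)
  then obtain B where B: "\<forall>x\<in>closure \<Omega>. \<bar>u x\<bar> \<le> B"
    using compact_imp_bounded[of "u ` closure \<Omega>"] by (auto simp: bounded_iff)
  obtain L where L: "L \<ge> 0" "\<And>x y. closed_segment x y \<subseteq> \<Omega> \<Longrightarrow> \<bar>u x - u y\<bar> \<le> L * norm (x - y)"
    using FE_lipschitz_on_segments[OF mesh u] by blast
  obtain G M where G: "has_weak_grad \<Omega> u G" "G \<in> borel_measurable (lebesgue_on \<Omega>)"
    "AE x in lebesgue_on \<Omega>. norm (G x) \<le> M"
    using ex_bounded_weak_grad[OF \<Omega>(1) cont _ L FE_differentiable_ae[OF mesh u], of B]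
      B closure_subset[of \<Omega>] by blast
  show w: "has_weak_grad \<Omega> u (weak_grad \<Omega> u)"
    unfolding weak_grad_def by (rule someI[of "has_weak_grad \<Omega> u", OF G(1)])
  have eq: "AE x in lebesgue_on \<Omega>. G x = weak_grad \<Omega> u x"
    using has_weak_grad_unique[OF \<Omega>(1) G(1) w] .
  \<comment> \<open>The chosen gradient is known only up to a null set; completeness of Lebesgue
    measure makes this enough for measurability.\<close>
  have "weak_grad \<Omega> u \<in> borel_measurable (lebesgue_on \<Omega>)"
  proof -
    have "(\<lambda>x. indicator \<Omega> x *\<^sub>R G x) \<in> borel_measurable lebesgue"
      using G(2) \<Omega>(1) by (simp add: borel_measurable_restrict_space_iff)
    moreover have "AE x in lebesgue. indicator \<Omega> x *\<^sub>R G x = indicator \<Omega> x *\<^sub>R weak_grad \<Omega> u x"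
      using eq \<Omega>(1) by (auto simp: AE_restrict_space_iff indicator_def elim!: eventually_mono)
    ultimately have "(\<lambda>x. indicator \<Omega> x *\<^sub>R weak_grad \<Omega> u x) \<in> borel_measurable lebesgue"
      by (rule borel_measurable_AE)
    then show ?thesis
      using \<Omega>(1) by (simp add: borel_measurable_restrict_space_iff)
  qed
  moreover have "AE x in lebesgue_on \<Omega>. norm (weak_grad \<Omega> u x) \<le> M"
    using G(3) eq by eventually_elim simp
  ultimately show "ess_bounded \<Omega> (weak_grad \<Omega> u)"
    unfolding ess_bounded_def by blast
qed


text \<open>Common scheme for the closure rules below: \<open>H\<close> turns bounds of the two
  arguments into a bound of the combination.\<close>

lemma ess_bounded_comp2:
  fixes f :: "real^'n \<Rightarrow> 'a::euclidean_space" and h :: "real^'n \<Rightarrow> 'b::euclidean_space"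
    and F :: "'a \<Rightarrow> 'b \<Rightarrow> 'c::euclidean_space"
  assumes f: "ess_bounded \<Omega> f" and h: "ess_bounded \<Omega> h"
    and F: "(\<lambda>x. F (f x) (h x)) \<in> borel_measurable (lebesgue_on \<Omega>)"
    and bound: "\<And>a b A B. norm a \<le> A \<Longrightarrow> norm b \<le> B \<Longrightarrow> norm (F a b) \<le> H A B"
  shows "ess_bounded \<Omega> (\<lambda>x. F (f x) (h x))"
proof -
  obtain A B where "AE x in lebesgue_on \<Omega>. norm (f x) \<le> A" "AE x in lebesgue_on \<Omega>. norm (h x) \<le> B"
    using f h unfolding ess_bounded_def by blast
  then have "AE x in lebesgue_on \<Omega>. norm (F (f x) (h x)) \<le> H A B"
    by eventually_elim (rule bound)
  then show ?thesis using F unfolding ess_bounded_def by blast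
qed

lemma ess_bounded_measurable: "ess_bounded \<Omega> f \<Longrightarrow> f \<in> borel_measurable (lebesgue_on \<Omega>)"
  by (simp add: ess_bounded_def)

lemma ess_bounded_add:
  assumes f: "ess_bounded \<Omega> f" and h: "ess_bounded \<Omega> h"
  shows "ess_bounded \<Omega> (\<lambda>x. f x + h x)"
  by (rule ess_bounded_comp2[OF f h, where H = "(+)"])
    (use assms[THEN ess_bounded_measurable] in \<open>auto intro: norm_triangle_mono\<close>)

lemma ess_bounded_diff:
  assumes f: "ess_bounded \<Omega> f" and h: "ess_bounded \<Omega> h"
  shows "ess_bounded \<Omega> (\<lambda>x. f x - h x)"
  by (rule ess_bounded_comp2[OF f h, where H = "(+)"])
    (use assms[THEN ess_bounded_measurable] in \<open>auto intro: order_trans[OF norm_triangle_ineq4] add_mono\<close>)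

lemma ess_bounded_scaleR:
  assumes f: "ess_bounded \<Omega> f" and h: "ess_bounded \<Omega> h"
  shows "ess_bounded \<Omega> (\<lambda>x. f x *\<^sub>R h x)"
proof (rule ess_bounded_comp2[OF f h, where H = "(*)"])
  show "norm (a *\<^sub>R b) \<le> A * B" if "norm a \<le> A" "norm b \<le> B" for a A and b :: 'b and B
    using mult_mono[OF that order_trans[OF norm_ge_zero that(1)] norm_ge_zero] by simp
qed (use assms[THEN ess_bounded_measurable] in auto)

lemma ess_bounded_inner:
  assumes f: "ess_bounded \<Omega> f" and h: "ess_bounded \<Omega> h"
  shows "ess_bounded \<Omega> (\<lambda>x. f x \<bullet> h x)"
proof (rule ess_bounded_comp2[OF f h, where H = "(*)"])
  show "norm (a \<bullet> b) \<le> A * B" if "norm a \<le> A" "norm b \<le> B" for a b :: 'b and A B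
    using Cauchy_Schwarz_ineq2[of a b] mult_mono[OF that order_trans[OF norm_ge_zero that(1)] norm_ge_zero]
    by simp
qed (use assms[THEN ess_bounded_measurable] in auto)

text \<open>Monotonicity alone gives Borel measurability, and it gives bounds by the values at the
  end points of the range. This covers the density and the derivatives of convex functions, whose
  continuity is thus never discussed.\<close>

lemma ess_bounded_mono_comp:
  fixes f :: "real \<Rightarrow> real"
  assumes f: "mono f" and u: "ess_bounded \<Omega> u"
  shows "ess_bounded \<Omega> (\<lambda>x. f (u x))"
proof -
  obtain B where B: "AE x in lebesgue_on \<Omega>. norm (u x) \<le> B"
    using u unfolding ess_bounded_def by blast
  have "AE x in lebesgue_on \<Omega>. norm (f (u x)) \<le> \<bar>f B\<bar> + \<bar>f (- B)\<bar>"
    using B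
  proof eventually_elim
    case (elim x)
    then have "f (- B) \<le> f (u x)" "f (u x) \<le> f B"
      by (auto intro!: monoD[OF f])
    then show ?case by auto
  qed
  moreover have "(\<lambda>x. f (u x)) \<in> borel_measurable (lebesgue_on \<Omega>)"
    using borel_measurable_mono[OF f] ess_bounded_measurable[OF u] by simp
  ultimately show ?thesis unfolding ess_bounded_def by blast
qed

lemma ess_bounded_Lp:
  assumes "open \<Omega>" "bounded \<Omega>" "ess_bounded \<Omega> f" "0 \<le> p"
  shows "f \<in> Lp \<Omega> p"
proof -
  obtain B where B: "AE x in lebesgue_on \<Omega>. norm (f x) \<le> B"
    using assms(3) unfolding ess_bounded_def by blast
  have f[measurable]: "f \<in> borel_measurable (lebesgue_on \<Omega>)" by (rule ess_bounded_measurable) fact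
  have "AE x in lebesgue_on \<Omega>. norm (norm (f x) powr p) \<le> B powr p"
    using B by eventually_elim (use assms(4) in \<open>auto intro: powr_mono2\<close>)
  then have "ess_bounded \<Omega> (\<lambda>x. norm (f x) powr p)"
    unfolding ess_bounded_def by (intro conjI exI) auto
  then show ?thesis
    unfolding Lp_def using f ess_bounded_integrable[OF assms(1,2)] by blast
qed

text \<open>The projection is controlled only on \<open>H1\<close>; this makes it applicable to a
  phase field living on the previous mesh.\<close>

lemma FE_H1:
  assumes "open \<Omega>" "bounded \<Omega>" "mesh \<Omega> \<T>" "u \<in> FE j \<Omega> \<T>"
  shows "u \<in> H1 \<Omega>"
proof -
  have "ess_bounded \<Omega> u"
    using assms(4) by (intro ess_bounded_cont[OF assms(1,2)]) (simp add: FE_def)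
  then have "u \<in> Lp \<Omega> 2" "weak_grad \<Omega> u \<in> Lp \<Omega> 2"
    using FE_weak_grad(2)[OF assms] by (intro ess_bounded_Lp[OF assms(1,2)]; simp)+
  then show ?thesis
    unfolding H1_def using FE_weak_grad(1)[OF assms] by blast
qed

text \<open>A choice need not be linear, but by uniqueness \<open>weak_grad\<close> respects
  differences up to a null set, which suffices under an integral.\<close>

lemma weak_grad_diff_FE:
  assumes \<Omega>: "open \<Omega>" "bounded \<Omega>" and mesh: "mesh \<Omega> \<T>" and "u \<in> FE j \<Omega> \<T>" "w \<in> FE j \<Omega> \<T>"
  shows "AE x in lebesgue_on \<Omega>. weak_grad \<Omega> (\<lambda>x. u x - w x) x = weak_grad \<Omega> u x - weak_grad \<Omega> w x"
  by (rule has_weak_grad_unique[OF \<Omega>(1)], rule FE_weak_grad[OF \<Omega> mesh FE_diff])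
    (use assms FE_weak_grad[OF \<Omega> mesh] has_weak_grad_diff[OF \<Omega>(1)] in auto)

section \<open>Tangent inequalities and pairings with a square integrable force\<close>

text \<open>The slope is taken at \<open>b\<close>, the point reached. This fits the convex part of
  the potential, which is evaluated at the new phase field; for the negated concave part the roles
  of the points are exchanged, which fits its evaluation at the projected old one.\<close>

lemma convex_tangent_le:
  fixes f :: "real \<Rightarrow> real"
  assumes "convex_on UNIV f" "f differentiable_on UNIV"
  shows "f b - f a \<le> deriv f b * (b - a)"
proof -
  have "(f has_real_derivative deriv f b) (at b)"
    using assms(2) by (simp add: DERIV_deriv_iff_real_differentiable differentiable_on_def)
  then have "deriv f b * (a - b) \<le> f a - f b"
    using convex_on_imp_above_tangent[OF assms(1), of b a "deriv f b"] by simp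
  then show ?thesis by (simp add: algebra_simps)
qed

text \<open>Add the tangent inequalities at the two points.\<close>

lemma convex_deriv_mono:
  fixes f :: "real \<Rightarrow> real"
  assumes "convex_on UNIV f" "f differentiable_on UNIV"
  shows "mono (deriv f)"
proof
  fix a b :: real assume "a \<le> b"
  have "f b - f a \<le> deriv f b * (b - a)" "f a - f b \<le> deriv f a * (a - b)"
    using convex_tangent_le[OF assms] by blast+
  then have "0 \<le> (deriv f b - deriv f a) * (b - a)" by (simp add: algebra_simps)
  then show "deriv f a \<le> deriv f b"
    using \<open>a \<le> b\<close> by (cases "a = b") (auto simp: zero_le_mult_iff)
qed

lemma L2_integrable:
  fixes g :: "real^'n \<Rightarrow> 'b::euclidean_space"
  assumes \<Omega>: "open \<Omega>" "bounded \<Omega>" and g: "g \<in> Lp \<Omega> 2"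
  shows "integrable (lebesgue_on \<Omega>) g"
proof (rule Bochner_Integration.integrable_bound)
  have "ess_bounded \<Omega> (\<lambda>x. 1::real)"
    unfolding ess_bounded_def by auto
  then show "integrable (lebesgue_on \<Omega>) (\<lambda>x. 1 + norm (g x) powr 2)"
    using g ess_bounded_integrable[OF \<Omega>, of "\<lambda>x. 1::real"] unfolding Lp_def by auto
  show "AE x in lebesgue_on \<Omega>. norm (g x) \<le> norm (1 + norm (g x) powr 2)"
  proof (rule AE_I2)
    fix x
    \<comment> \<open>Yields \<open>t \<le> 1 + t ^ 2\<close> for a norm \<open>t\<close>; the
      constant 1 is integrable because the domain is bounded.\<close>
    have "0 \<le> (norm (g x) - 1)\<^sup>2" by simp
    then have "2 * norm (g x) \<le> 1 + norm (g x) ^ 2"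
      by (simp add: power2_diff)
    then have "norm (g x) \<le> 1 + norm (g x) ^ 2" using norm_ge_zero[of "g x"] by linarith
    then show "norm (g x) \<le> norm (1 + norm (g x) powr 2)"
      by simp
  qed
qed (use g in \<open>simp add: Lp_def\<close>)

lemma integrable_inner_ess_bounded:
  fixes g :: "real^'n \<Rightarrow> 'b::euclidean_space"
  assumes g: "integrable (lebesgue_on \<Omega>) g" and h: "ess_bounded \<Omega> h"
  shows "integrable (lebesgue_on \<Omega>) (\<lambda>x. g x \<bullet> h x)"
proof -
  obtain B where B: "AE x in lebesgue_on \<Omega>. norm (h x) \<le> B"
    using h unfolding ess_bounded_def by blast
  show ?thesis
  proof (rule Bochner_Integration.integrable_bound)
    show "integrable (lebesgue_on \<Omega>) (\<lambda>x. B *\<^sub>R g x)" using g by simp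
    show "AE x in lebesgue_on \<Omega>. norm (g x \<bullet> h x) \<le> norm (B *\<^sub>R g x)"
      using B
    proof eventually_elim
      case (elim x)
      have "norm (g x \<bullet> h x) \<le> norm (g x) * norm (h x)" by (simp add: Cauchy_Schwarz_ineq2)
      also have "\<dots> \<le> norm (g x) * \<bar>B\<bar>" using elim by (intro mult_left_mono) auto
      finally show ?case by (simp add: mult.commute)
    qed
  qed (use g ess_bounded_measurable[OF h] in auto)
qed

subsection \<open>The energy inequality\<close>

text \<open>Skew symmetry in the last two arguments: the two integrals are literally the same term,
  so they cancel whether or not they exist, and the flux inside the first argument needs no
  estimate.\<close>

lemma trilinear_self: "trilinear \<Omega> u w w = 0"
  by (simp add: trilinear_def)

text \<open>One time step with its indices stripped off: \<open>r0\<close> and \<open>r1\<close> are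
  the densities one step apart, \<open>p\<close> is the projected old phase field, and
  \<open>\<kappa>\<close> stands for \<open>\<sigma> * \<epsilon>\<close>. The dissipation terms
  enter as bare reals \<open>D\<close> and \<open>M\<close>, since they pass through the argument
  unchanged.\<close>

lemma energy_step:
  fixes \<Omega> :: "(real^'n) set" and v0 v1 g :: "real^'n \<Rightarrow> real^'n"
  assumes \<Omega>: "open \<Omega>" "bounded \<Omega>" and \<tau>: "\<tau> > 0"
    and mesh: "mesh \<Omega> \<T>0" "mesh \<Omega> \<T>1"
    and g: "g \<in> Lp \<Omega> 2"
    and r: "ess_bounded \<Omega> r0" "ess_bounded \<Omega> r1"
    and v: "ess_bounded \<Omega> v0" "ess_bounded \<Omega> v1"
    and \<phi>: "\<phi>0 \<in> FE i \<Omega> \<T>0" "\<phi>1 \<in> FE j \<Omega> \<T>1" "p \<in> FE j \<Omega> \<T>1" and \<mu>: "ess_bounded \<Omega> \<mu>1"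
    and F: "continuous_on UNIV F" "\<And>s. F s = Fp s + Fm s"
    and Fp: "convex_on UNIV Fp" "Fp differentiable_on UNIV"
    and Fm: "concave_on UNIV Fm" "Fm differentiable_on UNIV"
    and momentum: "1 / (2 * \<tau>) * L2_inner \<Omega>
          (\<lambda>x. r1 x *\<^sub>R v1 x - r0 x *\<^sub>R v0 x + r0 x *\<^sub>R (v1 x - v0 x)) v1
        + D - L2_inner \<Omega> (\<lambda>x. \<mu>1 x *\<^sub>R weak_grad \<Omega> \<phi>0 x + r1 x *\<^sub>R g x) v1 = 0"
    and phase: "1 / \<tau> * L2_inner \<Omega> (\<lambda>x. \<phi>1 x - p x) \<mu>1 + M
        + L2_inner \<Omega> (\<lambda>x. v1 x \<bullet> weak_grad \<Omega> \<phi>0 x) \<mu>1 = 0"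
    and potential: "\<kappa> * L2_inner \<Omega> (weak_grad \<Omega> \<phi>1) (weak_grad \<Omega> (\<lambda>x. \<phi>1 x - p x))
        + L2_inner \<Omega> (\<lambda>x. deriv Fp (\<phi>1 x) + deriv Fm (p x)) (\<lambda>x. \<phi>1 x - p x)
        - L2_inner \<Omega> \<mu>1 (\<lambda>x. \<phi>1 x - p x) = 0"
    and energy_proj: "AE x in lebesgue_on \<Omega>. F (p x) + 1/2 * \<kappa> * (norm (weak_grad \<Omega> p x))\<^sup>2
        \<le> F (\<phi>0 x) + 1/2 * \<kappa> * (norm (weak_grad \<Omega> \<phi>0 x))\<^sup>2"
  shows "1/2 * L2_inner \<Omega> (\<lambda>x. r1 x *\<^sub>R v1 x) v1 + (LINT x|lebesgue_on \<Omega>. F (\<phi>1 x))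
        + 1/2 * \<kappa> * L2_inner \<Omega> (weak_grad \<Omega> \<phi>1) (weak_grad \<Omega> \<phi>1)
        + 1/2 * L2_inner \<Omega> (\<lambda>x. r0 x *\<^sub>R (v1 x - v0 x)) (\<lambda>x. v1 x - v0 x)
        + \<tau> * D + \<tau> * M
        + 1/2 * \<kappa> * (L2_norm \<Omega> (\<lambda>x. weak_grad \<Omega> \<phi>1 x - weak_grad \<Omega> p x))\<^sup>2
      \<le> 1/2 * L2_inner \<Omega> (\<lambda>x. r0 x *\<^sub>R v0 x) v0 + (LINT x|lebesgue_on \<Omega>. F (\<phi>0 x))
        + 1/2 * \<kappa> * L2_inner \<Omega> (weak_grad \<Omega> \<phi>0) (weak_grad \<Omega> \<phi>0)
        + \<tau> * L2_inner \<Omega> (\<lambda>x. r1 x *\<^sub>R g x) v1"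
proof -
  let ?M = "lebesgue_on \<Omega>"
  note int = ess_bounded_integrable[OF \<Omega>]
  note bdd = ess_bounded_add ess_bounded_diff ess_bounded_scaleR ess_bounded_inner
  have FE_cont: "continuous_on (closure \<Omega>) u" if "u \<in> FE k \<Omega> \<T>" for u :: "real^'n \<Rightarrow> real" and k \<T>
    using that by (simp add: FE_def)
  have \<phi>b: "ess_bounded \<Omega> \<phi>1" "ess_bounded \<Omega> p"
    using \<phi> FE_cont ess_bounded_cont[OF \<Omega>] by blast+
  have Fb: "ess_bounded \<Omega> (\<lambda>x. F (\<phi>0 x))" "ess_bounded \<Omega> (\<lambda>x. F (\<phi>1 x))" "ess_bounded \<Omega> (\<lambda>x. F (p x))"
    using \<phi>[THEN FE_cont] by (auto intro!: ess_bounded_cont[OF \<Omega>] continuous_on_compose2[OF F(1)])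
  have gb: "ess_bounded \<Omega> (weak_grad \<Omega> \<phi>0)" "ess_bounded \<Omega> (weak_grad \<Omega> \<phi>1)" "ess_bounded \<Omega> (weak_grad \<Omega> p)"
    using FE_weak_grad(2)[OF \<Omega>] mesh \<phi> by blast+

  \<comment> \<open>The two terms weighted by \<open>r0\<close> contribute
    \<open>r0 * (|v1|^2 - 2 * v0 \<bullet> v1)\<close>, which is a completed square minus
    \<open>r0 * |v0|^2\<close>. The old kinetic energy thus appears with the old density.\<close>
  have "L2_inner \<Omega> (\<lambda>x. r1 x *\<^sub>R v1 x - r0 x *\<^sub>R v0 x + r0 x *\<^sub>R (v1 x - v0 x)) v1
      = (LINT x|?M. (r1 x *\<^sub>R v1 x) \<bullet> v1 x + (r0 x *\<^sub>R (v1 x - v0 x)) \<bullet> (v1 x - v0 x) - (r0 x *\<^sub>R v0 x) \<bullet> v0 x)"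
    unfolding L2_inner_def
    by (intro Bochner_Integration.integral_cong refl)
      (simp add: inner_add_left inner_diff_left inner_diff_right, simp add: algebra_simps inner_commute)
  also have "\<dots> = L2_inner \<Omega> (\<lambda>x. r1 x *\<^sub>R v1 x) v1
      + L2_inner \<Omega> (\<lambda>x. r0 x *\<^sub>R (v1 x - v0 x)) (\<lambda>x. v1 x - v0 x) - L2_inner \<Omega> (\<lambda>x. r0 x *\<^sub>R v0 x) v0"
  proof -
    have I: "integrable ?M (\<lambda>x. (r1 x *\<^sub>R v1 x) \<bullet> v1 x)"
      "integrable ?M (\<lambda>x. (r0 x *\<^sub>R (v1 x - v0 x)) \<bullet> (v1 x - v0 x))"
      "integrable ?M (\<lambda>x. (r0 x *\<^sub>R v0 x) \<bullet> v0 x)"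
      by (intro int bdd r v)+
    show ?thesis
      unfolding L2_inner_def
      by (simp only: Bochner_Integration.integral_diff[OF Bochner_Integration.integrable_add[OF I(1,2)] I(3)]
          Bochner_Integration.integral_add[OF I(1,2)])
  qed
  finally have kinetic: "L2_inner \<Omega> (\<lambda>x. r1 x *\<^sub>R v1 x - r0 x *\<^sub>R v0 x + r0 x *\<^sub>R (v1 x - v0 x)) v1
      = L2_inner \<Omega> (\<lambda>x. r1 x *\<^sub>R v1 x) v1
      + L2_inner \<Omega> (\<lambda>x. r0 x *\<^sub>R (v1 x - v0 x)) (\<lambda>x. v1 x - v0 x) - L2_inner \<Omega> (\<lambda>x. r0 x *\<^sub>R v0 x) v0" .

  have force: "L2_inner \<Omega> (\<lambda>x. \<mu>1 x *\<^sub>R weak_grad \<Omega> \<phi>0 x + r1 x *\<^sub>R g x) v1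
      = L2_inner \<Omega> (\<lambda>x. v1 x \<bullet> weak_grad \<Omega> \<phi>0 x) \<mu>1 + L2_inner \<Omega> (\<lambda>x. r1 x *\<^sub>R g x) v1"
  proof -
    have 1: "integrable ?M (\<lambda>x. (v1 x \<bullet> weak_grad \<Omega> \<phi>0 x) \<bullet> \<mu>1 x)"
      by (intro int bdd v gb \<mu>)
    \<comment> \<open>The density is moved to the velocity, so that \<open>g\<close> is paired with
      one essentially bounded factor.\<close>
    have "integrable ?M (\<lambda>x. g x \<bullet> (r1 x *\<^sub>R v1 x))"
      by (intro integrable_inner_ess_bounded L2_integrable \<Omega> g bdd r v)
    then have 2: "integrable ?M (\<lambda>x. (r1 x *\<^sub>R g x) \<bullet> v1 x)" by simp
    have "L2_inner \<Omega> (\<lambda>x. \<mu>1 x *\<^sub>R weak_grad \<Omega> \<phi>0 x + r1 x *\<^sub>R g x) v1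
      = (LINT x|?M. (v1 x \<bullet> weak_grad \<Omega> \<phi>0 x) \<bullet> \<mu>1 x + (r1 x *\<^sub>R g x) \<bullet> v1 x)"
      unfolding L2_inner_def
      by (intro Bochner_Integration.integral_cong refl)
      (simp add: inner_add_left inner_diff_left inner_diff_right, simp add: algebra_simps inner_commute)
    also have "\<dots> = (LINT x|?M. (v1 x \<bullet> weak_grad \<Omega> \<phi>0 x) \<bullet> \<mu>1 x) + (LINT x|?M. (r1 x *\<^sub>R g x) \<bullet> v1 x)"
      by (rule Bochner_Integration.integral_add[OF 1 2])
    finally show ?thesis by (simp only: L2_inner_def)
  qed

  have grad: "2 * L2_inner \<Omega> (weak_grad \<Omega> \<phi>1) (weak_grad \<Omega> (\<lambda>x. \<phi>1 x - p x))
      = L2_inner \<Omega> (weak_grad \<Omega> \<phi>1) (weak_grad \<Omega> \<phi>1) - L2_inner \<Omega> (weak_grad \<Omega> p) (weak_grad \<Omega> p)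
        + (L2_norm \<Omega> (\<lambda>x. weak_grad \<Omega> \<phi>1 x - weak_grad \<Omega> p x))\<^sup>2"
  proof -
    let ?a = "weak_grad \<Omega> \<phi>1" and ?b = "weak_grad \<Omega> p"
    have db: "ess_bounded \<Omega> (weak_grad \<Omega> (\<lambda>x. \<phi>1 x - p x))"
      by (rule FE_weak_grad(2)[OF \<Omega> mesh(2) FE_diff[OF \<phi>(2,3)]])
    have "L2_inner \<Omega> ?a (weak_grad \<Omega> (\<lambda>x. \<phi>1 x - p x)) = (LINT x|?M. ?a x \<bullet> (?a x - ?b x))"
      unfolding L2_inner_def
    proof (rule integral_cong_AE)
      show "AE x in ?M. ?a x \<bullet> weak_grad \<Omega> (\<lambda>x. \<phi>1 x - p x) x = ?a x \<bullet> (?a x - ?b x)"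
        using weak_grad_diff_FE[OF \<Omega> mesh(2) \<phi>(2,3)] by eventually_elim simp
    qed (intro ess_bounded_measurable bdd gb db)+
    then have "2 * L2_inner \<Omega> ?a (weak_grad \<Omega> (\<lambda>x. \<phi>1 x - p x)) = (LINT x|?M. 2 * (?a x \<bullet> (?a x - ?b x)))"
      by simp
    \<comment> \<open>The identity
      \<open>2 * a \<bullet> (a - b) = |a|^2 - |b|^2 + |a - b|^2\<close> produces the numerical
      dissipation of the gradient energy.\<close>
    also have "\<dots> = (LINT x|?M. ?a x \<bullet> ?a x - ?b x \<bullet> ?b x + (?a x - ?b x) \<bullet> (?a x - ?b x))"
      by (intro Bochner_Integration.integral_cong refl)
      (simp add: inner_add_left inner_diff_left inner_diff_right, simp add: algebra_simps inner_commute)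
    also have "\<dots> = L2_inner \<Omega> ?a ?a - L2_inner \<Omega> ?b ?b + L2_inner \<Omega> (\<lambda>x. ?a x - ?b x) (\<lambda>x. ?a x - ?b x)"
      unfolding L2_inner_def
      by (subst Bochner_Integration.integral_add Bochner_Integration.integral_diff; (intro int bdd gb)?)+ simp
    also have "L2_inner \<Omega> (\<lambda>x. ?a x - ?b x) (\<lambda>x. ?a x - ?b x) = (L2_norm \<Omega> (\<lambda>x. ?a x - ?b x))\<^sup>2"
      unfolding L2_norm_def by (simp add: L2_inner_def)
    finally show ?thesis .
  qed

  have convexity: "(LINT x|?M. F (\<phi>1 x)) - (LINT x|?M. F (p x))
      \<le> L2_inner \<Omega> (\<lambda>x. deriv Fp (\<phi>1 x) + deriv Fm (p x)) (\<lambda>x. \<phi>1 x - p x)"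
  proof -
    \<comment> \<open>After negation the concave part obeys the same tangent and monotonicity lemmas
      as the convex one.\<close>
    have Fm': "convex_on UNIV (\<lambda>x. - Fm x)" "(\<lambda>x. - Fm x) differentiable_on UNIV"
      using Fm by (auto simp: concave_on_def)
    have dFm: "deriv (\<lambda>x. - Fm x) s = - deriv Fm s" for s
      using Fm(2) by (intro DERIV_imp_deriv DERIV_minus)
        (simp add: DERIV_deriv_iff_real_differentiable differentiable_on_def)
    have "ess_bounded \<Omega> (\<lambda>x. deriv Fp (\<phi>1 x))"
      by (rule ess_bounded_mono_comp[OF convex_deriv_mono[OF Fp] \<phi>b(1)])
    moreover have "ess_bounded \<Omega> (\<lambda>x. deriv (\<lambda>x. - Fm x) (p x))"
      by (rule ess_bounded_mono_comp[OF convex_deriv_mono[OF Fm'] \<phi>b(2)])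
    ultimately have "ess_bounded \<Omega> (\<lambda>x. (deriv Fp (\<phi>1 x) - deriv (\<lambda>x. - Fm x) (p x)) \<bullet> (\<phi>1 x - p x))"
      by (intro bdd \<phi>b)
    then have "integrable ?M (\<lambda>x. (deriv Fp (\<phi>1 x) + deriv Fm (p x)) \<bullet> (\<phi>1 x - p x))"
      unfolding dFm by (intro int) simp
    moreover have "F (\<phi>1 x) - F (p x) \<le> (deriv Fp (\<phi>1 x) + deriv Fm (p x)) \<bullet> (\<phi>1 x - p x)" for x
      using convex_tangent_le[OF Fp, of "\<phi>1 x" "p x"] convex_tangent_le[OF Fm', of "p x" "\<phi>1 x"]
      by (simp add: F(2) dFm algebra_simps)
    ultimately have "(LINT x|?M. F (\<phi>1 x) - F (p x)) \<le> (LINT x|?M. (deriv Fp (\<phi>1 x) + deriv Fm (p x)) \<bullet> (\<phi>1 x - p x))"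
      by (intro integral_mono[OF int[OF ess_bounded_diff[OF Fb(2,3)]]])
    then show ?thesis
      using int[OF Fb(2)] int[OF Fb(3)] by (simp add: L2_inner_def)
  qed

  have projection: "(LINT x|?M. F (p x)) + 1/2 * \<kappa> * L2_inner \<Omega> (weak_grad \<Omega> p) (weak_grad \<Omega> p)
      \<le> (LINT x|?M. F (\<phi>0 x)) + 1/2 * \<kappa> * L2_inner \<Omega> (weak_grad \<Omega> \<phi>0) (weak_grad \<Omega> \<phi>0)"
  proof -
    have I: "integrable ?M (\<lambda>x. weak_grad \<Omega> p x \<bullet> weak_grad \<Omega> p x)"
      "integrable ?M (\<lambda>x. weak_grad \<Omega> \<phi>0 x \<bullet> weak_grad \<Omega> \<phi>0 x)"
      by (intro int bdd gb)+
    have "(LINT x|?M. F (p x) + 1/2 * \<kappa> * (weak_grad \<Omega> p x \<bullet> weak_grad \<Omega> p x))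
        \<le> (LINT x|?M. F (\<phi>0 x) + 1/2 * \<kappa> * (weak_grad \<Omega> \<phi>0 x \<bullet> weak_grad \<Omega> \<phi>0 x))"
      using energy_proj I int[OF Fb(1)] int[OF Fb(3)]
      by (intro integral_mono_AE) (simp_all add: power2_norm_eq_inner)
    then show ?thesis
      using I int[OF Fb(1)] int[OF Fb(3)] by (simp add: L2_inner_def)
  qed

  have sym: "L2_inner \<Omega> \<mu>1 (\<lambda>x. \<phi>1 x - p x) = L2_inner \<Omega> (\<lambda>x. \<phi>1 x - p x) \<mu>1"
    by (simp add: L2_inner_def mult.commute)
  \<comment> \<open>With all integrals named, linear arithmetic remains. The coupling
    \<open>X\<close> cancels between the momentum and the phase equation, and \<open>W\<close>
    between the phase and the potential equation.\<close>
  define K1 K0 S W X Gr E where "K1 = L2_inner \<Omega> (\<lambda>x. r1 x *\<^sub>R v1 x) v1"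
    and "K0 = L2_inner \<Omega> (\<lambda>x. r0 x *\<^sub>R v0 x) v0"
    and "S = L2_inner \<Omega> (\<lambda>x. r0 x *\<^sub>R (v1 x - v0 x)) (\<lambda>x. v1 x - v0 x)"
    and "W = L2_inner \<Omega> (\<lambda>x. \<phi>1 x - p x) \<mu>1"
    and "X = L2_inner \<Omega> (\<lambda>x. v1 x \<bullet> weak_grad \<Omega> \<phi>0 x) \<mu>1"
    and "Gr = L2_inner \<Omega> (\<lambda>x. r1 x *\<^sub>R g x) v1"
    and "E = L2_inner \<Omega> (\<lambda>x. deriv Fp (\<phi>1 x) + deriv Fm (p x)) (\<lambda>x. \<phi>1 x - p x)"
  define N Nd where "N = L2_inner \<Omega> (weak_grad \<Omega> \<phi>1) (weak_grad \<Omega> (\<lambda>x. \<phi>1 x - p x))"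
    and "Nd = L2_inner \<Omega> (weak_grad \<Omega> \<phi>1) (weak_grad \<Omega> \<phi>1) - L2_inner \<Omega> (weak_grad \<Omega> p) (weak_grad \<Omega> p)
        + (L2_norm \<Omega> (\<lambda>x. weak_grad \<Omega> \<phi>1 x - weak_grad \<Omega> p x))\<^sup>2"
  have "1 / (2 * \<tau>) * (K1 + S - K0) + D - (X + Gr) = 0"
    using momentum unfolding kinetic force K1_def K0_def S_def X_def Gr_def .
  then have m: "1/2 * (K1 + S - K0) + \<tau> * D = \<tau> * X + \<tau> * Gr"
    using \<tau> by (simp add: field_simps)
  have "1 / \<tau> * W + M + X = 0"
    using phase unfolding W_def X_def .
  then have ph: "W + \<tau> * M + \<tau> * X = 0"
    using \<tau> by (simp add: field_simps)
  have po: "\<kappa> * N + E - W = 0"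
    using potential unfolding sym N_def E_def W_def .
  have "\<kappa> * N = 1/2 * \<kappa> * Nd"
    using grad unfolding N_def Nd_def by simp
  then have gr: "\<kappa> * N = 1/2 * \<kappa> * L2_inner \<Omega> (weak_grad \<Omega> \<phi>1) (weak_grad \<Omega> \<phi>1)
      - 1/2 * \<kappa> * L2_inner \<Omega> (weak_grad \<Omega> p) (weak_grad \<Omega> p)
      + 1/2 * \<kappa> * (L2_norm \<Omega> (\<lambda>x. weak_grad \<Omega> \<phi>1 x - weak_grad \<Omega> p x))\<^sup>2"
    unfolding Nd_def by (simp add: algebra_simps)
  define n1 np n0 nd where "n1 = 1/2 * \<kappa> * L2_inner \<Omega> (weak_grad \<Omega> \<phi>1) (weak_grad \<Omega> \<phi>1)"
    and "np = 1/2 * \<kappa> * L2_inner \<Omega> (weak_grad \<Omega> p) (weak_grad \<Omega> p)"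
    and "n0 = 1/2 * \<kappa> * L2_inner \<Omega> (weak_grad \<Omega> \<phi>0) (weak_grad \<Omega> \<phi>0)"
    and "nd = 1/2 * \<kappa> * (L2_norm \<Omega> (\<lambda>x. weak_grad \<Omega> \<phi>1 x - weak_grad \<Omega> p x))\<^sup>2"
  \<comment> \<open>Products with \<open>\<kappa>\<close> and \<open>\<tau>\<close> become atoms, so
    that the final combination is linear.\<close>
  define kN tD tM tX tG where "kN = \<kappa> * N" and "tD = \<tau> * D" and "tM = \<tau> * M" and "tX = \<tau> * X"
    and "tG = \<tau> * Gr"
  note defs = K1_def K0_def S_def Gr_def E_def n1_def np_def n0_def nd_def kN_def tD_def tM_def tX_def tG_def
  show ?thesis
    using m ph po gr convexity projection unfolding defs[symmetric] by argo
qed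


theorem theorem5:
  fixes \<Omega> :: "(real^'n) set"
    and \<sigma> \<epsilon> \<tau> :: real
    and g :: "real^'n \<Rightarrow> real^'n"
    and \<rho> \<eta> m F Fp Fm :: "real \<Rightarrow> real"
    and \<rho>_lo \<rho>_up \<eta>_lo \<eta>_up m_lo m_up \<rho>1 \<rho>2 C q :: real
    and G :: "(real^'n \<Rightarrow> real) \<Rightarrow> (real^'n \<Rightarrow> real) \<Rightarrow> (real^'n \<Rightarrow> real) \<Rightarrow> real"
    and \<T> :: "nat \<Rightarrow> (real^'n) set set"
    and P :: "nat \<Rightarrow> (real^'n \<Rightarrow> real) \<Rightarrow> real^'n \<Rightarrow> real"
    and v :: "nat \<Rightarrow> real^'n \<Rightarrow> real^'n"
    and \<phi> \<mu> :: "nat \<Rightarrow> real^'n \<Rightarrow> real"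
    and k l :: nat
  assumes dim: "CARD('n) = 2 \<or> CARD('n) = 3"
    and dom: "domain \<Omega>" "bounded \<Omega>"
    and params: "\<sigma> > 0" "\<epsilon> > 0" "\<tau> > 0"
    and g: "g \<in> Lp \<Omega> 2"
    and cont: "continuous_on UNIV \<rho>" "continuous_on UNIV \<eta>" "continuous_on UNIV m"
    and lower_pos: "\<rho>_lo > 0" "\<eta>_lo > 0" "m_lo > 0"
    and \<rho>_bounds: "\<And>s. \<rho>_lo \<le> \<rho> s \<and> \<rho> s \<le> \<rho>_up"
    and \<eta>_bounds: "\<And>s. \<eta>_lo \<le> \<eta> s \<and> \<eta> s \<le> \<eta>_up"
    and m_bounds: "\<And>s. m_lo \<le> m s \<and> m s \<le> m_up"
    and \<rho>_smooth: "\<And>i. (deriv ^^ i) \<rho> differentiable_on UNIV"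
    and \<rho>_mono: "mono \<rho>"
    and \<rho>12: "0 < \<rho>1" "\<rho>1 \<le> \<rho>2"
    and \<rho>_linear: "\<rho>1 < \<rho>2 \<Longrightarrow> \<forall>s. \<bar>s\<bar> < 1 + \<rho>1 / (\<rho>2 - \<rho>1) \<longrightarrow>
                     \<rho> s = (\<rho>2 - \<rho>1) / 2 * s + (\<rho>1 + \<rho>2) / 2"
    and \<rho>_const_up: "\<rho>1 < \<rho>2 \<Longrightarrow> \<rho> constant_on {1 + 2 * \<rho>1 / (\<rho>2 - \<rho>1) <..}"
    and \<rho>_const_lo: "\<rho>1 < \<rho>2 \<Longrightarrow> \<rho> constant_on {..< - 1 - 2 * \<rho>1 / (\<rho>2 - \<rho>1)}"
    and \<rho>_const: "\<rho>1 = \<rho>2 \<Longrightarrow> \<rho> constant_on UNIV"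
    and F_split: "\<And>s. F s = Fp s + Fm s"
    and F_C1: "F C1_differentiable_on UNIV"
    and Fp: "convex_on UNIV Fp" "Fp differentiable_on UNIV"
    and Fm: "concave_on UNIV Fm" "Fm differentiable_on UNIV"
    and growth_params: "C > 0" "q \<ge> 1" "CARD('n) = 3 \<Longrightarrow> q \<le> 4"
    and F_growth: "\<And>s. \<bar>F s\<bar> \<le> C * (1 + \<bar>s\<bar> powr q)"
    and Fp_growth: "\<And>s. \<bar>deriv Fp s\<bar> \<le> C * (1 + \<bar>s\<bar> powr (q - 1))"
    and Fm_growth: "\<And>s. \<bar>deriv Fm s\<bar> \<le> C * (1 + \<bar>s\<bar> powr (q - 1))"
    and Fp_operator: "superposition_H1_dual \<Omega> (deriv Fp)"
    and Fp_newton: "newton_derivative \<Omega> (superposition \<Omega> (deriv Fp)) G"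
    and G_nonneg: "\<And>\<xi> \<delta>. \<xi> \<in> H1 \<Omega> \<Longrightarrow> \<delta> \<in> H1 \<Omega> \<Longrightarrow> G \<xi> \<delta> \<delta> \<ge> 0"
    and mesh: "\<And>i. mesh \<Omega> (\<T> i)"
    and proj: "\<And>i. H1_projection \<Omega> (\<T> i) (P i)"
    and proj_Lp: "\<And>i u p. u \<in> H1 \<Omega> \<Longrightarrow> u \<in> Lp \<Omega> p \<Longrightarrow> 1 \<le> p \<Longrightarrow> (CARD('n) = 3 \<Longrightarrow> p < 6) \<Longrightarrow>
                    Lp_norm \<Omega> p (P i u) \<le> Lp_norm \<Omega> p u"
    and proj_grad: "\<And>i u r. u \<in> H1 \<Omega> \<Longrightarrow> 1 \<le> r \<Longrightarrow> r \<le> 2 \<Longrightarrow>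
                      Lp_norm \<Omega> r (weak_grad \<Omega> (P i u)) \<le> Lp_norm \<Omega> r (weak_grad \<Omega> u)"
    and \<phi>0: "\<phi> 0 \<in> FE 1 \<Omega> (\<T> 0)"
    and spaces: "\<And>i. i \<ge> 1 \<Longrightarrow> v i \<in> Hdiv \<Omega> (\<T> i) \<and> \<phi> i \<in> FE 1 \<Omega> (\<T> i) \<and> \<mu> i \<in> FE 1 \<Omega> (\<T> i)"
    and momentum: "\<And>i w. i \<ge> 1 \<Longrightarrow> w \<in> Hdiv \<Omega> (\<T> (i + 1)) \<Longrightarrow>
          1 / (2 * \<tau>) * L2_inner \<Omega>
             (\<lambda>x. \<rho> (\<phi> i x) *\<^sub>R v (i + 1) x - \<rho> (\<phi> (i - 1) x) *\<^sub>R v i x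
                   + \<rho> (\<phi> (i - 1) x) *\<^sub>R (v (i + 1) x - v i x)) w
          + trilinear \<Omega>
             (\<lambda>x. \<rho> (\<phi> i x) *\<^sub>R v i x
                   + (- deriv \<rho> (\<phi> i x) * m (\<phi> i x)) *\<^sub>R weak_grad \<Omega> (\<mu> i) x)
             (v (i + 1)) w
          + L2_inner \<Omega> (\<lambda>x. (2 * \<eta> (\<phi> i x)) *\<^sub>R sym_grad \<Omega> (v (i + 1)) x) (sym_grad \<Omega> w)
          - L2_inner \<Omega> (\<lambda>x. \<mu> (i + 1) x *\<^sub>R weak_grad \<Omega> (\<phi> i) x + \<rho> (\<phi> i x) *\<^sub>R g x) w = 0"
    and phase: "\<And>i \<Phi>. i \<ge> 1 \<Longrightarrow> \<Phi> \<in> FE 1 \<Omega> (\<T> (i + 1)) \<Longrightarrow>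
          1 / \<tau> * L2_inner \<Omega> (\<lambda>x. \<phi> (i + 1) x - P (i + 1) (\<phi> i) x) \<Phi>
          + L2_inner \<Omega> (\<lambda>x. m (\<phi> i x) *\<^sub>R weak_grad \<Omega> (\<mu> (i + 1)) x) (weak_grad \<Omega> \<Phi>)
          + L2_inner \<Omega> (\<lambda>x. v (i + 1) x \<bullet> weak_grad \<Omega> (\<phi> i) x) \<Phi> = 0"
    and potential: "\<And>i \<Psi>. i \<ge> 1 \<Longrightarrow> \<Psi> \<in> FE 1 \<Omega> (\<T> (i + 1)) \<Longrightarrow>
          \<sigma> * \<epsilon> * L2_inner \<Omega> (weak_grad \<Omega> (\<phi> (i + 1))) (weak_grad \<Omega> \<Psi>)
          + L2_inner \<Omega> (\<lambda>x. deriv Fp (\<phi> (i + 1) x) + deriv Fm (P (i + 1) (\<phi> i) x)) \<Psi>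
          - L2_inner \<Omega> (\<mu> (i + 1)) \<Psi> = 0"
    and energy_proj: "\<And>i. AE x in lebesgue_on \<Omega>.
          F (P (i + 1) (\<phi> i) x)
            + 1/2 * \<sigma> * \<epsilon> * (norm (weak_grad \<Omega> (P (i + 1) (\<phi> i)) x))\<^sup>2
          \<le> F (\<phi> i x) + 1/2 * \<sigma> * \<epsilon> * (norm (weak_grad \<Omega> (\<phi> i) x))\<^sup>2"
    and kl: "1 \<le> k" "k < l"
  shows
    "1/2 * L2_inner \<Omega> (\<lambda>x. \<rho> (\<phi> (k - 1) x) *\<^sub>R v k x) (v k)
       + (LINT x|lebesgue_on \<Omega>. F (\<phi> k x))
       + 1/2 * \<sigma> * \<epsilon> * L2_inner \<Omega> (weak_grad \<Omega> (\<phi> k)) (weak_grad \<Omega> (\<phi> k))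
       + \<tau> * (\<Sum>j = k..<l. L2_inner \<Omega> (\<lambda>x. \<rho> (\<phi> j x) *\<^sub>R g x) (v (j + 1)))
     \<ge> 1/2 * L2_inner \<Omega> (\<lambda>x. \<rho> (\<phi> (l - 1) x) *\<^sub>R v l x) (v l)
       + (LINT x|lebesgue_on \<Omega>. F (\<phi> l x))
       + 1/2 * \<sigma> * \<epsilon> * L2_inner \<Omega> (weak_grad \<Omega> (\<phi> l)) (weak_grad \<Omega> (\<phi> l))
       + 1/2 * (\<Sum>j = k..<l. L2_inner \<Omega>
            (\<lambda>x. \<rho> (\<phi> (j - 1) x) *\<^sub>R (v (j + 1) x - v j x)) (\<lambda>x. v (j + 1) x - v j x))
       + \<tau> * (\<Sum>j = k..<l. L2_inner \<Omega>
            (\<lambda>x. (2 * \<eta> (\<phi> j x)) *\<^sub>R sym_grad \<Omega> (v (j + 1)) x) (sym_grad \<Omega> (v (j + 1))))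
       + \<tau> * (\<Sum>j = k..<l. L2_inner \<Omega>
            (\<lambda>x. m (\<phi> j x) *\<^sub>R weak_grad \<Omega> (\<mu> (j + 1)) x) (weak_grad \<Omega> (\<mu> (j + 1))))
       + 1/2 * \<sigma> * \<epsilon> * (\<Sum>j = k..<l. (L2_norm \<Omega>
            (\<lambda>x. weak_grad \<Omega> (\<phi> (j + 1)) x - weak_grad \<Omega> (P (j + 1) (\<phi> j)) x))\<^sup>2)"
proof -
  define \<kappa> where "\<kappa> = \<sigma> * \<epsilon>"
  have \<Omega>: "open \<Omega>" "bounded \<Omega>"
    using dom by (auto simp: domain_def)
  \<comment> \<open>Index 0 is included because the first step already involves the density at
    \<open>\<phi> 0\<close>; velocities and chemical potentials start at index 1.\<close>
  have \<phi>: "\<phi> i \<in> FE 1 \<Omega> (\<T> i)" for i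
    using \<phi>0 spaces[of i] by (cases i) auto
  have vb: "ess_bounded \<Omega> (v i)" if "i \<ge> 1" for i
  proof (rule ess_bounded_cont[OF \<Omega>])
    have "continuous_on (closure \<Omega>) (\<lambda>x. \<chi> c. v i x $ c)"
      using spaces[OF that] by (intro continuous_on_vec_lambda) (auto simp: Hdiv_def FE_def)
    then show "continuous_on (closure \<Omega>) (v i)" by simp
  qed
  have \<rho>b: "ess_bounded \<Omega> (\<lambda>x. \<rho> (\<phi> i x))" for i
    using \<phi>[of i] by (intro ess_bounded_mono_comp[OF \<rho>_mono, where u = "\<phi> i"] ess_bounded_cont[OF \<Omega>]) (simp add: FE_def)
  have \<mu>b: "ess_bounded \<Omega> (\<mu> i)" if "i \<ge> 1" for i
    using spaces[OF that] by (intro ess_bounded_cont[OF \<Omega>]) (simp add: FE_def)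
  \<comment> \<open>The density lags one step behind the velocity: \<open>E (j + 1)\<close> then
    carries the density at \<open>j\<close>, exactly the new kinetic energy of the momentum
    equation, and the steps telescope.\<close>
  define E where "E j = 1/2 * L2_inner \<Omega> (\<lambda>x. \<rho> (\<phi> (j - 1) x) *\<^sub>R v j x) (v j)
       + (LINT x|lebesgue_on \<Omega>. F (\<phi> j x))
       + 1/2 * \<kappa> * L2_inner \<Omega> (weak_grad \<Omega> (\<phi> j)) (weak_grad \<Omega> (\<phi> j))" for j
  define S where "S j = L2_inner \<Omega>
      (\<lambda>x. \<rho> (\<phi> (j - 1) x) *\<^sub>R (v (j + 1) x - v j x)) (\<lambda>x. v (j + 1) x - v j x)" for j
  define D where "D j = L2_inner \<Omega>
      (\<lambda>x. (2 * \<eta> (\<phi> j x)) *\<^sub>R sym_grad \<Omega> (v (j + 1)) x) (sym_grad \<Omega> (v (j + 1)))" for j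
  define M where "M j = L2_inner \<Omega>
      (\<lambda>x. m (\<phi> j x) *\<^sub>R weak_grad \<Omega> (\<mu> (j + 1)) x) (weak_grad \<Omega> (\<mu> (j + 1)))" for j
  define R where "R j = (L2_norm \<Omega>
      (\<lambda>x. weak_grad \<Omega> (\<phi> (j + 1)) x - weak_grad \<Omega> (P (j + 1) (\<phi> j)) x))\<^sup>2" for j
  define W where "W j = L2_inner \<Omega> (\<lambda>x. \<rho> (\<phi> j x) *\<^sub>R g x) (v (j + 1))" for j
  have energy_decay: "E (j + 1) + 1/2 * S j + \<tau> * D j + \<tau> * M j + 1/2 * \<kappa> * R j \<le> E j + \<tau> * W j"
    if j: "j \<ge> 1" for j
  proof -
    have p: "P (j + 1) (\<phi> j) \<in> FE 1 \<Omega> (\<T> (j + 1))"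
      using proj[of "j + 1"] FE_H1[OF \<Omega> mesh \<phi>] by (auto simp: H1_projection_def)
    have j1: "j + 1 \<ge> 1" by simp
    have Fc: "continuous_on UNIV F"
      using F_C1 by (rule C1_differentiable_imp_continuous_on)
    have mom: "1 / (2 * \<tau>) * L2_inner \<Omega>
             (\<lambda>x. \<rho> (\<phi> j x) *\<^sub>R v (j + 1) x - \<rho> (\<phi> (j - 1) x) *\<^sub>R v j x
                   + \<rho> (\<phi> (j - 1) x) *\<^sub>R (v (j + 1) x - v j x)) (v (j + 1)) + D j
          - L2_inner \<Omega> (\<lambda>x. \<mu> (j + 1) x *\<^sub>R weak_grad \<Omega> (\<phi> j) x + \<rho> (\<phi> j x) *\<^sub>R g x) (v (j + 1)) = 0"
      using momentum[OF j, of "v (j + 1)"] spaces[OF j1] unfolding trilinear_self D_def by simp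
    have ph: "1 / \<tau> * L2_inner \<Omega> (\<lambda>x. \<phi> (j + 1) x - P (j + 1) (\<phi> j) x) (\<mu> (j + 1)) + M j
          + L2_inner \<Omega> (\<lambda>x. v (j + 1) x \<bullet> weak_grad \<Omega> (\<phi> j) x) (\<mu> (j + 1)) = 0"
      using phase[OF j, of "\<mu> (j + 1)"] spaces[OF j1] unfolding M_def by blast
    note po = potential[OF j FE_diff[OF \<phi> p], folded \<kappa>_def]
    have ep: "AE x in lebesgue_on \<Omega>.
          F (P (j + 1) (\<phi> j) x) + 1/2 * \<kappa> * (norm (weak_grad \<Omega> (P (j + 1) (\<phi> j)) x))\<^sup>2
          \<le> F (\<phi> j x) + 1/2 * \<kappa> * (norm (weak_grad \<Omega> (\<phi> j) x))\<^sup>2"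
      using energy_proj[of j] by (simp only: \<kappa>_def mult.assoc)
    show ?thesis
      using energy_step[OF \<Omega> params(3) mesh mesh g \<rho>b \<rho>b vb[OF j] vb[OF j1] \<phi> \<phi> p \<mu>b[OF j1]
          Fc F_split Fp Fm mom ph po ep]
      by (simp add: E_def S_def R_def W_def)
  qed
  from kl(2) have "k \<le> l" by simp
  \<comment> \<open>The induction starts at \<open>l = k\<close>, where all sums are empty and
    equality holds.\<close>
  then have "E l + 1/2 * (\<Sum>j = k..<l. S j) + \<tau> * (\<Sum>j = k..<l. D j) + \<tau> * (\<Sum>j = k..<l. M j)
      + 1/2 * \<kappa> * (\<Sum>j = k..<l. R j) \<le> E k + \<tau> * (\<Sum>j = k..<l. W j)"
  proof (induction l rule: dec_induct)
    case (step n)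
    then have "k \<le> n" "n \<ge> 1" using kl(1) by simp_all
    then show ?case
      using step.IH energy_decay[of n] by (simp add: algebra_simps)
  qed simp
  then show ?thesis
    by (simp only: E_def S_def D_def M_def R_def W_def \<kappa>_def mult.assoc)
qed

end
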